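(* Let $q\colon\mathbb{C}\setminus\mathbb{R}\to\mathbb{C}$ be a holomorphic function. Then $q$ is a quasi-Herglotz function if and only if both of the following hold: first, there exists a number $M\ge 0$ such that $$|q(z)|\le M\,\frac{1+|z|^2}{|\operatorname{Im}[z]|}\quad\text{for all } z\in\mathbb{C}\setminus\mathbb{R},$$ and, second, $$\sup_{r\in(0,1)}\int_{\mathbb{R}}|q(t+\mathrm{i}\,r)-q(t-\mathrm{i}\,r)|\,\frac{\mathrm{d}t}{1+t^2}<\infty.$$
   Context: A Herglotz function is a holomorphic function $h\colon\mathbb{C}\setminus\mathbb{R}\to\mathbb{C}$ with $\frac{\operatorname{Im}[h(z)]}{\operatorname{Im}[z]}\ge 0$ and $\overline{h(z)}=h(\overline{z})$ for all $z\in\mathbb{C}\setminus\mathbb{R}$. A function $q\colon\mathbb{C}\setminus\mathbb{R}\to\mathbb{C}$ is a quasi-Herglotz function if there exist Herglotz functions $h_1,h_2,h_3,h_4$ such that $q(z)=(h_1-h_2)(z)+\mathrm{i}\,(h_3-h_4)(z)$ for all $z\in\mathbb{C}\setminus\mathbb{R}$. *)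

theory Defs
  imports "HOL-Complex_Analysis.Complex_Analysis"
begin

text \<open>Functions on the complex plane without the real line are represented by total functions
  whose values on \<open>\<real>\<close> are irrelevant; \<open>- \<real>\<close> is the complement of the real line in the complex
  plane.\<close>

definition herglotz :: "(complex \<Rightarrow> complex) \<Rightarrow> bool" where
  "herglotz h \<longleftrightarrow> h holomorphic_on (- \<real>) \<and>
     (\<forall>z\<in>- \<real>. Im (h z) / Im z \<ge> 0 \<and> cnj (h z) = h (cnj z))"

definition quasi_herglotz :: "(complex \<Rightarrow> complex) \<Rightarrow> bool" where
  "quasi_herglotz q \<longleftrightarrow>
     (\<exists>h1 h2 h3 h4. herglotz h1 \<and> herglotz h2 \<and> herglotz h3 \<and> herglotz h4 \<and>
        (\<forall>z\<in>- \<real>. q z = (h1 z - h2 z) + \<i> * (h3 z - h4 z)))"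

end

theory Submission
  imports Defs "HOL-Real_Asymp.Real_Asymp"
begin

text \<open>
  A Herglotz function satisfies the growth bound by the Schwarz lemma
  (\<open>upper_half_plane_growth\<close>), and its jump across the real line between height \<open>r\<close> and \<open>- r\<close> is
  \<open>2 \<i> Im (h (t + \<i> r))\<close>, a function of constant argument. Integrated against \<open>1 / (1 + t\<^sup>2)\<close>, this is
  essentially the mean value property of the nonnegative harmonic function \<open>Im h\<close> with respect to the
  point \<open>\<i>\<close>, so the integral is bounded by a multiple of the growth constant
  (\<open>nn_integral_Im_boundary_le\<close>). Both properties pass to linear combinations.

  Conversely, let \<open>q\<close> satisfy both conditions. For \<open>0 < r < 1\<close> let \<open>q\<^sub>r z = q (z \<plusminus> \<i> r)\<close>, the sign being
  that of \<open>Im z\<close>, and let \<open>d\<^sub>r t = q (t + \<i> r) - q (t - \<i> r)\<close>. Cauchy's formula with the kernel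
  \<open>1 / ((s - z) (1 + s\<^sup>2))\<close> in both half-planes gives (\<open>jump_representation\<close>)

  \<open>q\<^sub>r z = a\<^sub>r + b\<^sub>r z + 1 / (2 \<pi> \<i>) \<integral> (1 + t z) / (t - z) d\<^sub>r t / (1 + t\<^sup>2) dt\<close>.

  Splitting \<open>d\<^sub>r / (2 \<pi> \<i>)\<close> into the positive and negative parts of its real and imaginary part turns the
  integral into a combination of four Herglotz functions (\<open>nev_transform_split\<close>). They are locally
  bounded uniformly in \<open>r\<close>, because the integrals of \<open>\<bar>d\<^sub>r\<bar> / (1 + t\<^sup>2)\<close> are. By Montel's theorem they converge
  along a sequence \<open>r \<rightarrow> 0\<close> (\<open>herglotz_convergent_subsequence\<close>), and the limit is the decomposition of \<open>q\<close>.
  The limit is taken of the functions rather than of the measures \<open>d\<^sub>r / (1 + t\<^sup>2) dt\<close>: mass of these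
  measures may escape to infinity, where it turns into a multiple of \<open>z\<close>.

  The analytic difficulty lies in the contours: on a box with lower corners \<open>\<plusminus> R\<close> the growth bound alone does
  not make the outer sides negligible near the real line. Therefore the integrand is multiplied by
  \<open>1 - s\<^sup>2 / R\<^sup>2\<close>, which vanishes at these corners and tends to 1 (\<open>weighted_bound_on_outer_sides\<close>).
\<close>

section \<open>Damped Cauchy integrals over large boxes\<close>

text \<open>A function with \<open>\<bar>f s\<bar> \<le> M (1 + \<bar>s\<bar>\<^sup>2) / Im s\<close> may be of order \<open>R\<^sup>2\<close> near the two points where the boundary
  of a large box meets the real line. The factor \<open>1 - s\<^sup>2 / R\<^sup>2\<close> vanishes at exactly these points
  \<open>\<plusminus> R\<close>, lies in \<open>[0, 1]\<close> on the segment between them, and tends to 1 as \<open>R\<close> grows.\<close>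

definition damp :: "real \<Rightarrow> complex \<Rightarrow> complex" where
  "damp R s = 1 - s\<^sup>2 / of_real (R\<^sup>2)"

lemma damp_uminus [simp]: "damp R (- s) = damp R s"
  by (simp add: damp_def)

lemma damp_of_real: "damp R (of_real t) = of_real (1 - t\<^sup>2 / R\<^sup>2)"
  by (simp add: damp_def)

lemma holomorphic_on_damp [holomorphic_intros]: "damp R holomorphic_on S"
  unfolding damp_def by (cases "R = 0") (auto intro!: holomorphic_intros)

lemma continuous_on_damp [continuous_intros]:
  "continuous_on S f \<Longrightarrow> continuous_on S (\<lambda>x. damp R (f x))"
  unfolding damp_def by (cases "R = 0") (auto intro!: continuous_intros)

text \<open>On each of the three outer sides \<open>\<bar>R\<^sup>2 - s\<^sup>2\<bar> \<le> 3 R Im s\<close>, so that the zero of the damping factor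
  cancels the singular factor \<open>1 / Im s\<close> of the growth bound.\<close>

lemma weighted_bound_on_outer_sides:
  fixes f :: "complex \<Rightarrow> complex"
  assumes f: "\<And>s. Im s > 0 \<Longrightarrow> cmod (f s) \<le> M * (1 + (cmod s)\<^sup>2) / Im s"
    and "M \<ge> 0" "R \<ge> 1"
    and s: "\<bar>Re s\<bar> = R \<and> 0 \<le> Im s \<and> Im s \<le> R \<or> \<bar>Re s\<bar> \<le> R \<and> Im s = R"
  shows "cmod (f s * damp R s) \<le> 9 * M * R"
proof (cases "Im s = 0")
  case True
  then have "Re s = R \<or> Re s = - R" "s = of_real (Re s)"
    using s \<open>R \<ge> 1\<close> by (auto simp: complex_eq_iff)
  then have "s\<^sup>2 = of_real (R\<^sup>2)"
    by (metis of_real_power power2_minus)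
  then show ?thesis
    using assms by (simp add: damp_def)
next
  case False
  define y where "y = Im s"
  have y: "0 < y" "y \<le> R"
    using False s \<open>R \<ge> 1\<close> by (auto simp: y_def)
  have x: "(Re s)\<^sup>2 \<le> R\<^sup>2"
    using s \<open>R \<ge> 1\<close> by (auto simp flip: abs_le_square_iff)
  have y2: "y\<^sup>2 \<le> R\<^sup>2" "1 \<le> R\<^sup>2"
    using y \<open>R \<ge> 1\<close> by (auto simp: power_mono)
  have s2: "(cmod s)\<^sup>2 \<le> 2 * R\<^sup>2"
    using x y2 by (simp add: cmod_power2 y_def)
  \<comment> \<open>On a vertical side this is the zero of \<open>R\<^sup>2 - s\<^sup>2\<close> at the corner, on the top side the trivial bound.\<close>
  have w: "cmod (of_real (R\<^sup>2) - s\<^sup>2) \<le> 3 * R * y"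
    using s
  proof
    assume a: "\<bar>Re s\<bar> = R \<and> 0 \<le> Im s \<and> Im s \<le> R"
    then have R2: "R\<^sup>2 = (Re s)\<^sup>2" and R: "R = \<bar>Re s\<bar>"
      by auto
    have "of_real (R\<^sup>2) - s\<^sup>2 = Complex (y\<^sup>2) (- (2 * Re s * y))"
      unfolding R2 y_def by (simp add: complex_eq_iff power2_eq_square)
    also have "cmod \<dots> \<le> \<bar>y\<^sup>2\<bar> + \<bar>- (2 * Re s * y)\<bar>"
      using cmod_le[of "Complex (y\<^sup>2) (- (2 * Re s * y))"] by simp
    also have "\<dots> = y * y + 2 * R * y"
      using y R by (simp add: abs_mult power2_eq_square)
    also have "\<dots> \<le> 3 * R * y"
      using mult_right_mono[of y R y] y by simp
    finally show ?thesis .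
  next
    assume a: "\<bar>Re s\<bar> \<le> R \<and> Im s = R"
    have "cmod (of_real (R\<^sup>2) - s\<^sup>2) \<le> R\<^sup>2 + (cmod s)\<^sup>2"
      by (metis abs_of_nonneg norm_of_real norm_power norm_triangle_ineq4 zero_le_power2)
    also have "\<dots> \<le> 3 * R * y"
      using s2 a by (simp add: y_def power2_eq_square)
    finally show ?thesis .
  qed
  have "cmod (f s) \<le> M * (3 * R\<^sup>2) / y"
  proof -
    have "cmod (f s) \<le> M * (1 + (cmod s)\<^sup>2) / y"
      using f[of s] y by (simp add: y_def)
    also have "\<dots> \<le> M * (3 * R\<^sup>2) / y"
      using y s2 y2 \<open>M \<ge> 0\<close> by (intro divide_right_mono mult_left_mono) auto
    finally show ?thesis .
  qed
  moreover have "cmod (damp R s) \<le> 3 * R * y / R\<^sup>2"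
  proof -
    have "damp R s = (of_real (R\<^sup>2) - s\<^sup>2) / of_real (R\<^sup>2)"
      using \<open>R \<ge> 1\<close> by (simp add: damp_def diff_divide_distrib)
    then have "cmod (damp R s) = cmod (of_real (R\<^sup>2) - s\<^sup>2) / R\<^sup>2"
      by (simp add: norm_divide norm_power)
    then show ?thesis
      using w by (simp add: divide_right_mono)
  qed
  ultimately have "cmod (f s * damp R s) \<le> M * (3 * R\<^sup>2) / y * (3 * R * y / R\<^sup>2)"
    unfolding norm_mult using y \<open>M \<ge> 0\<close> by (intro mult_mono) auto
  also have "\<dots> = 9 * M * R"
    using y \<open>R \<ge> 1\<close> by (simp add: field_simps power2_eq_square)
  finally show ?thesis .
qed

abbreviation upper_box :: "real \<Rightarrow> real \<Rightarrow> complex" where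
  "upper_box R \<equiv> rectpath (- of_real R) (Complex R R)"

lemma path_image_upper_box:
  assumes "R \<ge> 0"
  shows "s \<in> path_image (upper_box R) \<longleftrightarrow>
    \<bar>Re s\<bar> \<le> R \<and> 0 \<le> Im s \<and> Im s \<le> R \<and> (\<bar>Re s\<bar> = R \<or> Im s = 0 \<or> Im s = R)"
  using assms by (subst path_image_rectpath_cbox_minus_box)
    (auto simp: in_box_complex_iff in_cbox_complex_iff)

text \<open>The three outer sides have total length \<open>4 R\<close>.\<close>

lemma integral_real_side_approx:
  fixes F :: "complex \<Rightarrow> complex"
  assumes "R > 0" "B \<ge> 0" and cont: "continuous_on (path_image (upper_box R)) F"
    and B: "\<And>s. \<bar>Re s\<bar> = R \<and> 0 \<le> Im s \<and> Im s \<le> R \<or> \<bar>Re s\<bar> \<le> R \<and> Im s = R \<Longrightarrow> cmod (F s) \<le> B"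
  shows "cmod (integral {-R..R} (\<lambda>t. F (of_real t)) - contour_integral (upper_box R) F) \<le> 4 * R * B"
proof -
  define a1 a2 a3 a4 where "a1 = - complex_of_real R" and "a2 = complex_of_real R"
    and "a3 = Complex R R" and "a4 = Complex (- R) R"
  note a = a1_def a2_def a3_def a4_def
  have path: "upper_box R = linepath a1 a2 +++ linepath a2 a3 +++ linepath a3 a4 +++ linepath a4 a1"
    by (simp add: rectpath_def Let_def a complex_of_real_def complex_eq_iff)
  have im: "path_image (upper_box R) = closed_segment a1 a2 \<union> closed_segment a2 a3 \<union>
      closed_segment a3 a4 \<union> closed_segment a4 a1"
    unfolding path by (simp add: path_image_join Un_assoc)
  have int: "F contour_integrable_on linepath a1 a2" "F contour_integrable_on linepath a2 a3"
    "F contour_integrable_on linepath a3 a4" "F contour_integrable_on linepath a4 a1"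
    by (intro contour_integrable_continuous_linepath continuous_on_subset[OF cont]; auto simp: im)+
  have "contour_integral (upper_box R) F = contour_integral (linepath a1 a2) F
    + (contour_integral (linepath a2 a3) F + (contour_integral (linepath a3 a4) F
    + contour_integral (linepath a4 a1) F))"
    unfolding path using int by (simp add: contour_integrable_joinI valid_path_join)
  moreover have "contour_integral (linepath a1 a2) F = integral {-R..R} (\<lambda>t. F (of_real t))"
    using \<open>R > 0\<close> by (subst contour_integral_linepath_Reals_eq) (auto simp: a)
  moreover have "cmod (contour_integral (linepath a2 a3) F) \<le> B * cmod (a3 - a2)"
    by (intro contour_integral_bound_linepath int B \<open>B \<ge> 0\<close>)
      (use \<open>R > 0\<close> in \<open>auto simp: a closed_segment_same_Re closed_segment_eq_real_ivl\<close>)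
  moreover have "cmod (contour_integral (linepath a3 a4) F) \<le> B * cmod (a4 - a3)"
    by (intro contour_integral_bound_linepath int B \<open>B \<ge> 0\<close>)
      (use \<open>R > 0\<close> in \<open>auto simp: a closed_segment_same_Im closed_segment_eq_real_ivl\<close>)
  moreover have "cmod (contour_integral (linepath a4 a1) F) \<le> B * cmod (a1 - a4)"
    by (intro contour_integral_bound_linepath int B \<open>B \<ge> 0\<close>)
      (use \<open>R > 0\<close> in \<open>auto simp: a closed_segment_same_Re closed_segment_eq_real_ivl\<close>)
  moreover have "cmod (a3 - a2) = R" "cmod (a4 - a3) = 2 * R" "cmod (a1 - a4) = R"
    using \<open>R > 0\<close> by (simp_all add: a cmod_def real_sqrt_mult)
  ultimately have "cmod (contour_integral (upper_box R) F - integral {-R..R} (\<lambda>t. F (of_real t))) \<le> 4 * R * B"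
    using norm_triangle_ineq[of "contour_integral (linepath a2 a3) F" "contour_integral (linepath a3 a4) F + contour_integral (linepath a4 a1) F"]
      norm_triangle_ineq[of "contour_integral (linepath a3 a4) F" "contour_integral (linepath a4 a1) F"]
    by (simp add: algebra_simps)
  then show ?thesis
    by (simp only: norm_minus_commute)
qed

lemma Cauchy_formula_upper_box:
  assumes f: "f holomorphic_on {s. Im s > - r}" and "r > 0" "cmod a < R" "Im a \<noteq> 0"
  shows "((\<lambda>s. f s / (s - a)) has_contour_integral
           (if Im a > 0 then 2 * pi * \<i> * f a else 0)) (upper_box R)"
proof -
  have R: "R > 0"
    using assms(3) norm_ge_zero[of a] by linarith
  have ab: "\<bar>Re a\<bar> < R" "\<bar>Im a\<bar> < R"
    using abs_Re_le_cmod[of a] abs_Im_le_cmod[of a] \<open>cmod a < R\<close> by linarith+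
  note [simp] = path_image_upper_box[OF less_imp_le[OF R]]
  show ?thesis
  proof (cases "Im a > 0")
    case True
    have "((\<lambda>s. f s / (s - a)) has_contour_integral
        2 * pi * \<i> * winding_number (upper_box R) a * f a) (upper_box R)"
    proof (rule Cauchy_integral_formula_convex_simple[OF _ f])
      show "convex {s. Im s > - r}"
        by (rule convex_halfspace_Im_gt)
      show "a \<in> interior {s. Im s > - r}"
        using True \<open>r > 0\<close> by (subst interior_open) (auto simp: open_halfspace_Im_gt)
      show "path_image (upper_box R) \<subseteq> {s. Im s > - r} - {a}"
        using ab True \<open>r > 0\<close> by auto
    qed auto
    moreover have "winding_number (upper_box R) a = 1"
      using ab True by (intro winding_number_rectpath) (auto simp: in_box_complex_iff)
    ultimately show ?thesis
      using True by simp
  next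
    case False
    let ?S = "{s. Im s > max (- r) (Im a)}"
    have "((\<lambda>s. f s / (s - a)) has_contour_integral 0) (upper_box R)"
    proof (rule Cauchy_theorem_convex_simple)
      show "(\<lambda>s. f s / (s - a)) holomorphic_on ?S"
        by (intro holomorphic_intros holomorphic_on_subset[OF f]) auto
      show "convex ?S"
        by (rule convex_halfspace_Im_gt)
      show "path_image (upper_box R) \<subseteq> ?S"
        using False \<open>Im a \<noteq> 0\<close> \<open>r > 0\<close> by auto
    qed auto
    then show ?thesis
      using False by simp
  qed
qed

text \<open>The basic estimate of both directions. The error is \<open>O(R\<^sup>2 sup \<bar>k\<bar>)\<close>: it tends to 0 for a kernel of
  order \<open>\<bar>s\<bar> ^ (- 3)\<close>, and stays bounded for a kernel of order \<open>\<bar>s\<bar> ^ (- 2)\<close>.\<close>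

lemma weighted_Cauchy_integral_approx:
  fixes f k :: "complex \<Rightarrow> complex"
  assumes f: "f holomorphic_on {s. Im s > - r}" and "r > 0"
    and growth: "\<And>s. Im s > 0 \<Longrightarrow> cmod (f s) \<le> M * (1 + (cmod s)\<^sup>2) / Im s"
    and "M \<ge> 0" "R \<ge> 1" "B \<ge> 0"
    and k: "continuous_on (path_image (upper_box R)) k" "\<And>s. cmod s \<ge> R \<Longrightarrow> cmod (k s) \<le> B"
    and I: "((\<lambda>s. f s * damp R s * k s) has_contour_integral I) (upper_box R)"
  shows "cmod (integral {-R..R} (\<lambda>t. f (of_real t) * damp R (of_real t) * k (of_real t)) - I)
    \<le> 36 * M * R\<^sup>2 * B"
proof -
  have "cmod (integral {-R..R} (\<lambda>t. f (of_real t) * damp R (of_real t) * k (of_real t))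
      - contour_integral (upper_box R) (\<lambda>s. f s * damp R s * k s)) \<le> 4 * R * (9 * M * R * B)"
  proof (rule integral_real_side_approx)
    show "continuous_on (path_image (upper_box R)) (\<lambda>s. f s * damp R s * k s)"
      by (intro continuous_intros k continuous_on_subset[OF holomorphic_on_imp_continuous_on[OF f]])
        (use \<open>r > 0\<close> \<open>R \<ge> 1\<close> in \<open>auto simp: path_image_upper_box\<close>)
  next
    fix s
    assume s: "\<bar>Re s\<bar> = R \<and> 0 \<le> Im s \<and> Im s \<le> R \<or> \<bar>Re s\<bar> \<le> R \<and> Im s = R"
    have "R \<le> cmod s"
      using s abs_Re_le_cmod[of s] abs_Im_le_cmod[of s] by linarith
    then show "cmod (f s * damp R s * k s) \<le> 9 * M * R * B"
      unfolding norm_mult[of "f s * damp R s"]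
      by (intro mult_mono weighted_bound_on_outer_sides growth s k) (use assms in auto)
  qed (use assms in auto)
  then show ?thesis
    unfolding contour_integral_unique[OF I] by (simp add: power2_eq_square mult_ac)
qed

text \<open>A Cauchy formula for the half-plane with kernel \<open>1 / ((s - z) (1 + s\<^sup>2))\<close>, whose extra factor
  \<open>1 / (1 + s\<^sup>2)\<close> makes the outer sides negligible. It also creates a pole at \<open>\<i>\<close>, so that the value
  \<open>f \<i>\<close> enters; for \<open>z\<close> in the lower half-plane this is the only pole inside the box.\<close>

lemma damped_Cauchy_limit:
  fixes f :: "complex \<Rightarrow> complex"
  assumes f: "f holomorphic_on {s. Im s > - r}" and "r > 0"
    and growth: "\<And>s. Im s > 0 \<Longrightarrow> cmod (f s) \<le> M * (1 + (cmod s)\<^sup>2) / Im s"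
    and "M \<ge> 0" and z: "Im z \<noteq> 0" "z \<noteq> \<i>" "z \<noteq> - \<i>"
  shows "(\<lambda>n. integral {- real n..real n}
            (\<lambda>t. f (of_real t) * damp (real n) (of_real t) * (1 / ((of_real t - z) * (1 + (of_real t)\<^sup>2)))))
         \<longlonglongrightarrow> 2 * pi * \<i> * ((if Im z > 0 then f z else 0) / (1 + z\<^sup>2) + f \<i> / ((\<i> - z) * (2 * \<i>)))"
    (is "?J \<longlonglongrightarrow> ?L")
proof -
  define k where "k = (\<lambda>s. 1 / ((s - z) * (1 + s\<^sup>2)))"
  define I where "I = (\<lambda>n. 2 * pi * \<i> * ((if Im z > 0 then f z * damp (real n) z else 0) / (1 + z\<^sup>2)
    + f \<i> * damp (real n) \<i> / ((\<i> - z) * (2 * \<i>))))"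
  have factor: "1 + s\<^sup>2 = (s - \<i>) * (s + \<i>)" for s :: complex
    by (simp add: algebra_simps power2_eq_square)
  have nz: "1 + z\<^sup>2 \<noteq> 0"
    using z unfolding factor by (auto simp: eq_neg_iff_add_eq_0)
  have eventually_large: "eventually (\<lambda>n. real n \<ge> 2 * cmod z + 2) sequentially"
    by (meson eventually_sequentiallyI le_nat_iff nat_ceiling_le_eq)
  have "eventually (\<lambda>n. cmod (?J n - I n) \<le> 144 * M / real n) sequentially"
    using eventually_large
  proof eventually_elim
    case (elim n)
    define R where "R = real n"
    have R: "R \<ge> 2 * cmod z + 2"
      using elim by (simp add: R_def)
    then have "R \<ge> 2"
      using norm_ge_zero[of z] by linarith
    define g where "g = (\<lambda>s. f s * damp R s)"
    have g: "g holomorphic_on {s. Im s > - r}"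
      unfolding g_def by (intro holomorphic_intros f)
    note [simp] = path_image_upper_box
    have ne: "s \<noteq> z" "s \<noteq> \<i>" "s \<noteq> - \<i>" if "s \<in> path_image (upper_box R)" for s
      using that R abs_Re_le_cmod[of z] abs_Im_le_cmod[of z] z \<open>R \<ge> 2\<close> by auto
    have ik: "((\<lambda>s. g s * k s) has_contour_integral I n) (upper_box R)"
    proof -
      have 1: "((\<lambda>s. g s / (s - z)) has_contour_integral
          (if Im z > 0 then 2 * pi * \<i> * g z else 0)) (upper_box R)"
        by (rule Cauchy_formula_upper_box[OF g \<open>r > 0\<close>]) (use R norm_ge_zero[of z] z in linarith)+
      have 2: "((\<lambda>s. g s / (s - \<i>)) has_contour_integral
          (if Im \<i> > 0 then 2 * pi * \<i> * g \<i> else 0)) (upper_box R)"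
        by (rule Cauchy_formula_upper_box[OF g \<open>r > 0\<close>]) (use \<open>R \<ge> 2\<close> in auto)
      have 3: "((\<lambda>s. g s / (s - (- \<i>))) has_contour_integral
          (if Im (- \<i>) > 0 then 2 * pi * \<i> * g (- \<i>) else 0)) (upper_box R)"
        by (rule Cauchy_formula_upper_box[OF g \<open>r > 0\<close>]) (use \<open>R \<ge> 2\<close> in auto)
      have "((\<lambda>s. (1 / (1 + z\<^sup>2)) * (g s / (s - z)) + (1 / ((\<i> - z) * (2 * \<i>))) * (g s / (s - \<i>))
            + (1 / ((\<i> + z) * (2 * \<i>))) * (g s / (s - (- \<i>)))) has_contour_integral
          ((1 / (1 + z\<^sup>2)) * (if Im z > 0 then 2 * pi * \<i> * g z else 0)
            + (1 / ((\<i> - z) * (2 * \<i>))) * (if Im \<i> > 0 then 2 * pi * \<i> * g \<i> else 0)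
            + (1 / ((\<i> + z) * (2 * \<i>))) * (if Im (- \<i>) > 0 then 2 * pi * \<i> * g (- \<i>) else 0))) (upper_box R)"
        by (intro has_contour_integral_add has_contour_integral_lmul 1 2 3)
      also have "(1 / (1 + z\<^sup>2)) * (if Im z > 0 then 2 * pi * \<i> * g z else 0)
            + (1 / ((\<i> - z) * (2 * \<i>))) * (if Im \<i> > 0 then 2 * pi * \<i> * g \<i> else 0)
            + (1 / ((\<i> + z) * (2 * \<i>))) * (if Im (- \<i>) > 0 then 2 * pi * \<i> * g (- \<i>) else 0) = I n"
        by (simp add: I_def g_def R_def distrib_left)
      finally show ?thesis
      proof (rule has_contour_integral_eq)
        fix s assume "s \<in> path_image (upper_box R)"
        from ne[OF this] have s: "s - z \<noteq> 0" "s - \<i> \<noteq> 0" "s + \<i> \<noteq> 0"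
          by (auto simp: eq_neg_iff_add_eq_0)
        have z': "\<i> - z \<noteq> 0" "\<i> + z \<noteq> 0" "z - \<i> \<noteq> 0" "z + \<i> \<noteq> 0"
          using z by (auto simp: eq_neg_iff_add_eq_0 add.commute)
        \<comment> \<open>Partial fractions in \<open>s\<close> reduce the kernel to three Cauchy kernels.\<close>
        have "(1 / (1 + z\<^sup>2)) * (1 / (s - z)) + (1 / ((\<i> - z) * (2 * \<i>))) * (1 / (s - \<i>))
            + (1 / ((\<i> + z) * (2 * \<i>))) * (1 / (s + \<i>)) = k s"
          unfolding k_def factor using s z'
          by (simp add: divide_simps) (simp add: algebra_simps power2_eq_square)
        then have "g s * ((1 / (1 + z\<^sup>2)) * (1 / (s - z)) + (1 / ((\<i> - z) * (2 * \<i>))) * (1 / (s - \<i>))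
            + (1 / ((\<i> + z) * (2 * \<i>))) * (1 / (s + \<i>))) = g s * k s"
          by simp
        then show "(1 / (1 + z\<^sup>2)) * (g s / (s - z)) + (1 / ((\<i> - z) * (2 * \<i>))) * (g s / (s - \<i>))
            + (1 / ((\<i> + z) * (2 * \<i>))) * (g s / (s - (- \<i>))) = g s * k s"
          by (simp add: distrib_left)
      qed
    qed
    have "cmod (integral {-R..R} (\<lambda>t. f (of_real t) * damp R (of_real t) * k (of_real t)) - I n)
        \<le> 36 * M * R\<^sup>2 * (4 / R ^ 3)"
    proof (rule weighted_Cauchy_integral_approx[OF f \<open>r > 0\<close> growth \<open>M \<ge> 0\<close>])
      show "continuous_on (path_image (upper_box R)) k"
        unfolding k_def factor
        by (intro continuous_intros) (use ne in \<open>auto simp: eq_neg_iff_add_eq_0\<close>)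
      show "((\<lambda>s. f s * damp R s * k s) has_contour_integral I n) (upper_box R)"
        using ik by (simp add: g_def)
    next
      fix s assume s: "cmod s \<ge> R"
      have "cmod (s - z) \<ge> R / 2"
        using norm_triangle_ineq2[of s z] s R by linarith
      moreover have "cmod (1 + s\<^sup>2) \<ge> R\<^sup>2 / 2"
      proof -
        have "cmod (s\<^sup>2) \<ge> R\<^sup>2"
          using s \<open>R \<ge> 2\<close> by (simp add: norm_power power_mono)
        moreover have "R\<^sup>2 \<ge> 2\<^sup>2"
          using \<open>R \<ge> 2\<close> by (intro power_mono) auto
        ultimately show ?thesis
          using norm_triangle_ineq2[of "s\<^sup>2" "-1"] by (simp add: add.commute)
      qed
      ultimately have "cmod ((s - z) * (1 + s\<^sup>2)) \<ge> R / 2 * (R\<^sup>2 / 2)"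
        unfolding norm_mult using \<open>R \<ge> 2\<close> by (intro mult_mono) auto
      then have "cmod ((s - z) * (1 + s\<^sup>2)) \<ge> R ^ 3 / 4"
        by (simp add: power2_eq_square power3_eq_cube)
      moreover have "R ^ 3 / 4 > 0"
        using \<open>R \<ge> 2\<close> by simp
      ultimately have "1 / cmod ((s - z) * (1 + s\<^sup>2)) \<le> 1 / (R ^ 3 / 4)"
        by (intro divide_left_mono mult_pos_pos) linarith+
      then show "cmod (k s) \<le> 4 / R ^ 3"
        by (simp add: k_def norm_divide)
    qed (use \<open>R \<ge> 2\<close> in auto)
    also have "\<dots> = 144 * M / R"
      using \<open>R \<ge> 2\<close> by (simp add: power2_eq_square power3_eq_cube)
    finally show ?case
      by (simp add: k_def R_def)
  qed
  moreover have "(\<lambda>n. 144 * M / real n) \<longlonglongrightarrow> 0"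
    by real_asymp
  ultimately have "(\<lambda>n. ?J n - I n) \<longlonglongrightarrow> 0"
    by (rule Lim_null_comparison)
  moreover have "I \<longlonglongrightarrow> ?L"
  proof -
    have damp: "(\<lambda>n. damp (real n) s) \<longlonglongrightarrow> 1" for s
    proof -
      have "(\<lambda>n. 1 - s\<^sup>2 * of_real (1 / (real n)\<^sup>2)) \<longlonglongrightarrow> 1 - s\<^sup>2 * of_real 0"
        by (intro tendsto_intros) real_asymp
      then show ?thesis
        by (simp add: damp_def divide_inverse)
    qed
    have "(\<lambda>n. if Im z > 0 then f z * damp (real n) z else 0) \<longlonglongrightarrow> (if Im z > 0 then f z * 1 else 0)"
      using tendsto_mult[OF tendsto_const damp] by simp
    then have "I \<longlonglongrightarrow> 2 * pi * \<i> * ((if Im z > 0 then f z * 1 else 0) / (1 + z\<^sup>2)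
      + f \<i> * 1 / ((\<i> - z) * (2 * \<i>)))"
      unfolding I_def using nz z by (intro tendsto_intros damp) auto
    then show ?thesis
      by (simp cong: if_cong)
  qed
  ultimately show ?thesis
    using tendsto_add[of "\<lambda>n. ?J n - I n" 0 sequentially I ?L] by simp
qed

section \<open>Vertical shifts and jumps\<close>

text \<open>Both half-planes are moved away from the real line by \<open>r\<close>; the new function extends continuously to
  the real line from either side.\<close>

abbreviation away_shift :: "(complex \<Rightarrow> complex) \<Rightarrow> real \<Rightarrow> complex \<Rightarrow> complex" where
  "away_shift q r z \<equiv> q (if Im z > 0 then z + \<i> * of_real r else z - \<i> * of_real r)"

abbreviation jump :: "(complex \<Rightarrow> complex) \<Rightarrow> real \<Rightarrow> real \<Rightarrow> complex" where
  "jump q r t \<equiv> q (Complex t r) - q (Complex t (- r))"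

text \<open>The shift increases \<open>Im s\<close> and changes \<open>\<bar>s\<bar>\<close> by less than 1. That the new constant is the same for all \<open>r < 1\<close>
  makes the later bounds uniform in \<open>r\<close>.\<close>

lemma growth_shift:
  fixes q :: "complex \<Rightarrow> complex"
  assumes q: "\<And>z. z \<in> - \<real> \<Longrightarrow> cmod (q z) \<le> M * ((1 + (cmod z)\<^sup>2) / \<bar>Im z\<bar>)"
    and "M \<ge> 0" "0 < r" "r < 1" "Im s > 0"
  shows "cmod (q (s + \<i> * of_real r)) \<le> 3 * M * (1 + (cmod s)\<^sup>2) / Im s"
proof -
  have "r * r < 1"
    using assms mult_strict_mono[of r 1 r 1] by simp
  have "cmod (s + \<i> * of_real r) \<le> cmod s + 1"
    using norm_triangle_ineq[of s "\<i> * of_real r"] assms by (simp add: norm_mult)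
  then have "(cmod (s + \<i> * of_real r))\<^sup>2 \<le> (cmod s + 1)\<^sup>2"
    by (intro power_mono) auto
  also have "\<dots> \<le> 2 * (cmod s)\<^sup>2 + 2"
    using zero_le_power2[of "cmod s - 1"] by (simp add: power2_eq_square algebra_simps)
  finally have "1 + (cmod (s + \<i> * of_real r))\<^sup>2 \<le> 3 * (1 + (cmod s)\<^sup>2)"
    using zero_le_power2[of "cmod s"] unfolding distrib_left by linarith
  then have "M * ((1 + (cmod (s + \<i> * of_real r))\<^sup>2) / \<bar>Im (s + \<i> * of_real r)\<bar>)
    \<le> M * (3 * (1 + (cmod s)\<^sup>2) / Im s)"
    using assms by (intro mult_left_mono frac_le) auto
  then show ?thesis
    using q[of "s + \<i> * of_real r"] assms by (simp add: complex_is_Real_iff mult_ac)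
qed

lemma continuous_on_horizontal_line:
  assumes "q holomorphic_on - \<real>" "c \<noteq> 0"
  shows "continuous_on A (\<lambda>t. q (Complex t c))"
  by (rule continuous_on_compose2[OF holomorphic_on_imp_continuous_on[OF assms(1)]])
    (use assms(2) in \<open>auto intro!: continuous_intros simp: Complex_eq complex_is_Real_iff\<close>)

lemma one_plus_of_real_sq: "1 + (complex_of_real t)\<^sup>2 = of_real (1 + t\<^sup>2)"
  by simp

section \<open>Growth and jump of Herglotz functions\<close>

text \<open>Harnack's inequality in the form of the Schwarz lemma: after adding \<open>\<i>\<close> the values have imaginary part
  at least 1, and the Cayley transforms of source and target turn \<open>f\<close> into a self-map of the unit disc
  that fixes 0.\<close>

lemma upper_half_plane_growth:
  assumes f: "f holomorphic_on {s. Im s > 0}" and im: "\<And>s. Im s > 0 \<Longrightarrow> Im (f s) \<ge> 0"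
    and z: "Im z > 0"
  shows "cmod (f z) \<le> (1 + 2 * cmod (f \<i> + \<i>)) * ((1 + (cmod z)\<^sup>2) / Im z)"
proof -
  \<comment> \<open>The inverse Cayley transform maps the disc to the upper half-plane, 0 to \<open>\<i>\<close> and \<open>w\<close> to \<open>z\<close>.\<close>
  define c where "c = (\<lambda>w. \<i> * (1 + w) / (1 - w))"
  define G where "G = (\<lambda>z. f z + \<i>)"
  define a where "a = G \<i>"
  define S where "S = (\<lambda>w. (G (c w) - a) / (G (c w) - cnj a))"
  define w where "w = (z - \<i>) / (z + \<i>)"
  have Im_c: "Im (c w) > 0" if "cmod w < 1" for w
  proof -
    have "w \<noteq> 1"
      using that by auto
    then have "c w = \<i> * ((1 + w) * cnj (1 - w)) / of_real ((cmod (1 - w))\<^sup>2)"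
      unfolding c_def complex_norm_square by simp
    then have "Im (c w) = Re ((1 + w) * cnj (1 - w)) / (cmod (1 - w))\<^sup>2"
      by (simp only: Im_divide_of_real) simp
    also have "Re ((1 + w) * cnj (1 - w)) = 1 - (cmod w)\<^sup>2"
      unfolding cmod_power2 by (simp add: algebra_simps power2_eq_square)
    finally show ?thesis
      using that \<open>w \<noteq> 1\<close> by (simp add: abs_square_less_1)
  qed
  have ImG: "Im (G s) \<ge> 1" if "Im s > 0" for s
    using im[OF that] by (simp add: G_def)
  have Ima: "Im a \<ge> 1"
    using ImG[of \<i>] by (simp add: a_def)
  have lt: "cmod (G s - a) < cmod (G s - cnj a)" if "Im s > 0" for s
  proof -
    have "Im (G s) * Im a > 0"
      using ImG[OF that] Ima by simp
    then have "(cmod (G s - a))\<^sup>2 < (cmod (G s - cnj a))\<^sup>2"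
      unfolding cmod_power2 by (simp add: algebra_simps power2_eq_square)
    then show ?thesis
      by (rule power_less_imp_less_base) simp
  qed
  have ne: "G s - cnj a \<noteq> 0" if "Im s > 0" for s
    using lt[OF that] norm_ge_zero[of "G s - a"] by auto
  have S_le: "cmod (S w) \<le> cmod w" if "cmod w < 1" for w
  proof (rule Schwarz_Lemma(1))
    have c: "c holomorphic_on ball 0 1"
      unfolding c_def by (intro holomorphic_intros) auto
    have "(\<lambda>w. f (c w)) holomorphic_on ball 0 1"
      by (rule holomorphic_on_compose_gen[OF c f, unfolded o_def]) (auto simp: Im_c)
    then show "S holomorphic_on ball 0 1"
      unfolding S_def G_def by (intro holomorphic_intros) (use ne Im_c in \<open>auto simp: G_def\<close>)
    show "S 0 = 0"
      by (simp add: S_def c_def a_def)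
    show "cmod (S v) < 1" if "cmod v < 1" for v
      using lt[OF Im_c[OF that]] ne[OF Im_c[OF that]] by (simp add: S_def norm_divide divide_less_eq_1)
  qed (use that in auto)
  have zi: "(cmod (z + \<i>))\<^sup>2 - (cmod (z - \<i>))\<^sup>2 = 4 * Im z"
    unfolding cmod_power2 by (simp add: algebra_simps power2_eq_square)
  have zi_less: "cmod (z - \<i>) < cmod (z + \<i>)"
  proof (rule power_less_imp_less_base)
    show "(cmod (z - \<i>))\<^sup>2 < (cmod (z + \<i>))\<^sup>2"
      using zi z by linarith
  qed simp
  then have zi_pos: "cmod (z + \<i>) > 0"
    by (meson norm_ge_zero order.strict_trans1)
  have "cmod w < 1"
    using zi_less zi_pos by (simp add: w_def norm_divide)
  moreover have "c w = z"
  proof -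
    have "z + \<i> \<noteq> 0"
      using zi_pos by auto
    then have "1 + w = 2 * z / (z + \<i>)" "1 - w = 2 * \<i> / (z + \<i>)"
      by (simp_all add: w_def field_simps)
    with \<open>z + \<i> \<noteq> 0\<close> show ?thesis
      by (simp add: c_def)
  qed
  ultimately have "cmod (G z - a) / cmod (G z - cnj a) \<le> cmod (z - \<i>) / cmod (z + \<i>)"
    using S_le[of w] by (simp add: S_def w_def norm_divide)
  then have "cmod (G z - a) * cmod (z + \<i>) \<le> cmod (z - \<i>) * cmod (G z - cnj a)"
    using zi_pos ne[OF z] by (simp add: field_simps)
  moreover have "cmod (G z) - cmod a \<le> cmod (G z - a)"
    by (rule norm_triangle_ineq2)
  moreover have "cmod (G z - cnj a) \<le> cmod (G z) + cmod a"
    using norm_triangle_ineq4[of "G z" "cnj a"] by simp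
  ultimately have "(cmod (G z) - cmod a) * cmod (z + \<i>) \<le> cmod (z - \<i>) * (cmod (G z) + cmod a)"
    by (meson mult_left_mono mult_right_mono norm_ge_zero order_trans)
  then have "cmod (G z) * (cmod (z + \<i>) - cmod (z - \<i>)) \<le> cmod a * (cmod (z + \<i>) + cmod (z - \<i>))"
    by (simp add: algebra_simps)
  \<comment> \<open>Multiplying by the sum produces the difference of squares \<open>4 Im z\<close>.\<close>
  then have "cmod (G z) * (cmod (z + \<i>) - cmod (z - \<i>)) * (cmod (z + \<i>) + cmod (z - \<i>))
      \<le> cmod a * (cmod (z + \<i>) + cmod (z - \<i>)) * (cmod (z + \<i>) + cmod (z - \<i>))"
    by (rule mult_right_mono) auto
  also have "cmod (G z) * (cmod (z + \<i>) - cmod (z - \<i>)) * (cmod (z + \<i>) + cmod (z - \<i>)) = cmod (G z) * (4 * Im z)"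
    unfolding zi[symmetric] by (simp add: algebra_simps power2_eq_square)
  also have "cmod a * (cmod (z + \<i>) + cmod (z - \<i>)) * (cmod (z + \<i>) + cmod (z - \<i>))
      = cmod a * (cmod (z + \<i>) + cmod (z - \<i>))\<^sup>2"
    by (simp add: power2_eq_square)
  also have "\<dots> \<le> cmod a * (8 * (1 + (cmod z)\<^sup>2))"
  proof (rule mult_left_mono)
    have "cmod (z + \<i>) + cmod (z - \<i>) \<le> 2 * (cmod z + 1)"
      using norm_triangle_ineq[of z \<i>] norm_triangle_ineq4[of z \<i>] by simp
    then have "(cmod (z + \<i>) + cmod (z - \<i>))\<^sup>2 \<le> (2 * (cmod z + 1))\<^sup>2"
      by (intro power_mono) auto
    also have "\<dots> \<le> 8 * (1 + (cmod z)\<^sup>2)"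
      using zero_le_power2[of "cmod z - 1"] by (simp add: power2_eq_square algebra_simps)
    finally show "(cmod (z + \<i>) + cmod (z - \<i>))\<^sup>2 \<le> 8 * (1 + (cmod z)\<^sup>2)" .
  qed auto
  finally have "cmod (G z) \<le> 2 * cmod a * ((1 + (cmod z)\<^sup>2) / Im z)"
    using z by (simp add: field_simps)
  moreover have "cmod (f z) \<le> cmod (G z) + 1"
    using norm_triangle_ineq4[of "G z" \<i>] by (simp add: G_def)
  moreover have "1 \<le> (1 + (cmod z)\<^sup>2) / Im z"
  proof -
    have "Im z \<le> cmod z"
      using abs_Im_le_cmod[of z] by linarith
    moreover have "2 * cmod z \<le> 1 + (cmod z)\<^sup>2"
      using zero_le_power2[of "cmod z - 1"] by (simp add: power2_eq_square algebra_simps)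
    ultimately show ?thesis
      using z norm_ge_zero[of z] by (simp del: norm_ge_zero)
  qed
  ultimately show ?thesis
    unfolding a_def G_def distrib_right by linarith
qed

text \<open>With the kernel \<open>1 / (1 + s\<^sup>2)\<close> the contour estimate bounds the damped integrals of \<open>f\<close> uniformly in
  the size of the box. This says nothing about the integral of \<open>\<bar>f\<bar>\<close>, but the imaginary part is
  nonnegative, so that Fatou's lemma removes the damping.\<close>

lemma nn_integral_Im_boundary_le:
  assumes f: "f holomorphic_on {s. Im s > - r}" and "r > 0"
    and growth: "\<And>s. Im s > 0 \<Longrightarrow> cmod (f s) \<le> M * (1 + (cmod s)\<^sup>2) / Im s"
    and "M \<ge> 0" and im: "\<And>t. Im (f (of_real t)) \<ge> 0"
  shows "(\<integral>\<^sup>+ t. ennreal (Im (f (of_real t)) / (1 + t\<^sup>2)) \<partial>lborel) \<le> ennreal (100 * M)"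
proof -
  define k where "k = (\<lambda>s::complex. 1 / (1 + s\<^sup>2))"
  define u where "u = (\<lambda>n t. Im (f (of_real t)) / (1 + t\<^sup>2) * (1 - t\<^sup>2 / (real n)\<^sup>2))"
  define v where "v = (\<lambda>n t. indicator {- real n..real n} t * u n t)"
  have factor: "1 + s\<^sup>2 = (s - \<i>) * (s + \<i>)" for s :: complex
    by (simp add: algebra_simps power2_eq_square)
  have pos: "1 + t\<^sup>2 > 0" for t :: real
    using zero_le_power2[of t] by linarith
  have ne1: "1 + (complex_of_real t)\<^sup>2 \<noteq> 0" for t
    unfolding one_plus_of_real_sq of_real_eq_0_iff using pos[of t] by simp
  have contf: "continuous_on A (\<lambda>t. f (complex_of_real t))" for A
    by (rule continuous_on_compose2[OF holomorphic_on_imp_continuous_on[OF f]])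
      (use \<open>r > 0\<close> in \<open>auto intro!: continuous_intros\<close>)
  have cont: "continuous_on A (\<lambda>t. f (of_real t) * damp (real n) (of_real t) * k (of_real t))" for n A
    unfolding k_def by (intro continuous_intros contf) (use ne1 in auto)
  have u_eq: "u n t = Im (f (of_real t) * damp (real n) (of_real t) * k (of_real t))" for n t
  proof -
    have "f (of_real t) * damp (real n) (of_real t) * k (of_real t)
        = of_real ((1 - t\<^sup>2 / (real n)\<^sup>2) / (1 + t\<^sup>2)) * f (of_real t)"
      unfolding k_def damp_of_real one_plus_of_real_sq by (simp add: mult_ac)
    moreover have "Im (of_real a * w) = a * Im w" for a w
      by simp
    ultimately have "Im (f (of_real t) * damp (real n) (of_real t) * k (of_real t))
        = (1 - t\<^sup>2 / (real n)\<^sup>2) / (1 + t\<^sup>2) * Im (f (of_real t))"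
      by (simp only:)
    then show ?thesis
      by (simp only: u_def mult.commute times_divide_eq_left times_divide_eq_right)
  qed
  have contu: "continuous_on A (u n)" for n A
    unfolding u_eq[abs_def] by (intro continuous_intros cont)
  have u_nonneg: "u n t \<ge> 0" if "t \<in> {- real n..real n}" for n t
  proof -
    have "t\<^sup>2 \<le> (real n)\<^sup>2"
      using that by (auto simp: abs_le_iff simp flip: abs_le_square_iff)
    then have "t\<^sup>2 / (real n)\<^sup>2 \<le> 1"
      by (auto simp: divide_le_eq_1)
    then show ?thesis
      unfolding u_def using im[of t] pos[of t] by simp
  qed
  \<comment> \<open>The contour estimate contributes \<open>72 M\<close>, the residue at \<open>\<i>\<close> at most \<open>10 M\<close>.\<close>
  have bound: "integral {- real n..real n} (u n) \<le> 100 * M" if "n \<ge> 2" for n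
  proof -
    define R where "R = real n"
    define I where "I = pi * (f \<i> * damp R \<i>)"
    have "R \<ge> 2"
      using that by (simp add: R_def)
    define g where "g = (\<lambda>s. f s * damp R s)"
    have g: "g holomorphic_on {s. Im s > - r}"
      unfolding g_def by (intro holomorphic_intros f)
    have ne: "s \<noteq> \<i>" "s \<noteq> - \<i>" if "s \<in> path_image (upper_box R)" for s
      using that \<open>R \<ge> 2\<close> by (auto simp: path_image_upper_box)
    have ik: "((\<lambda>s. g s * k s) has_contour_integral I) (upper_box R)"
    proof -
      have 2: "((\<lambda>s. g s / (s - \<i>)) has_contour_integral
          (if Im \<i> > 0 then 2 * pi * \<i> * g \<i> else 0)) (upper_box R)"
        by (rule Cauchy_formula_upper_box[OF g \<open>r > 0\<close>]) (use \<open>R \<ge> 2\<close> in auto)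
      have 3: "((\<lambda>s. g s / (s - (- \<i>))) has_contour_integral
          (if Im (- \<i>) > 0 then 2 * pi * \<i> * g (- \<i>) else 0)) (upper_box R)"
        by (rule Cauchy_formula_upper_box[OF g \<open>r > 0\<close>]) (use \<open>R \<ge> 2\<close> in auto)
      have "((\<lambda>s. (1 / (2 * \<i>)) * (g s / (s - \<i>) - g s / (s - (- \<i>)))) has_contour_integral
          ((1 / (2 * \<i>)) * ((if Im \<i> > 0 then 2 * pi * \<i> * g \<i> else 0)
            - (if Im (- \<i>) > 0 then 2 * pi * \<i> * g (- \<i>) else 0)))) (upper_box R)"
        by (intro has_contour_integral_diff has_contour_integral_lmul 2 3)
      also have "(1 / (2 * \<i>)) * ((if Im \<i> > 0 then 2 * pi * \<i> * g \<i> else 0)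
            - (if Im (- \<i>) > 0 then 2 * pi * \<i> * g (- \<i>) else 0)) = I"
        by (simp add: I_def g_def complex_eq_iff algebra_simps)
      finally show ?thesis
      proof (rule has_contour_integral_eq)
        fix s assume "s \<in> path_image (upper_box R)"
        from ne[OF this] have s: "s - \<i> \<noteq> 0" "s + \<i> \<noteq> 0"
          by (auto simp: eq_neg_iff_add_eq_0)
        then show "(1 / (2 * \<i>)) * (g s / (s - \<i>) - g s / (s - (- \<i>))) = g s * k s"
          unfolding k_def factor by (simp add: field_simps)
      qed
    qed
    have "cmod (integral {-R..R} (\<lambda>t. f (of_real t) * damp R (of_real t) * k (of_real t)) - I)
        \<le> 36 * M * R\<^sup>2 * (2 / R\<^sup>2)"
    proof (rule weighted_Cauchy_integral_approx[OF f \<open>r > 0\<close> growth \<open>M \<ge> 0\<close>])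
      show "continuous_on (path_image (upper_box R)) k"
        unfolding k_def factor
        by (intro continuous_intros) (use ne in \<open>auto simp: eq_neg_iff_add_eq_0\<close>)
      show "((\<lambda>s. f s * damp R s * k s) has_contour_integral I) (upper_box R)"
        using ik by (simp add: g_def)
    next
      fix s assume s: "cmod s \<ge> R"
      have "cmod (s\<^sup>2) \<ge> R\<^sup>2"
        using s \<open>R \<ge> 2\<close> by (simp add: norm_power power_mono)
      moreover have "R\<^sup>2 \<ge> 2\<^sup>2"
        using \<open>R \<ge> 2\<close> by (intro power_mono) auto
      ultimately have "cmod (1 + s\<^sup>2) \<ge> R\<^sup>2 / 2" "R\<^sup>2 / 2 > 0"
        using norm_triangle_ineq2[of "s\<^sup>2" "-1"] \<open>R \<ge> 2\<close> by (auto simp: add.commute)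
      then have "1 / cmod (1 + s\<^sup>2) \<le> 1 / (R\<^sup>2 / 2)"
        by (intro divide_left_mono mult_pos_pos) linarith+
      then show "cmod (k s) \<le> 2 / R\<^sup>2"
        by (simp add: k_def norm_divide)
    qed (use \<open>R \<ge> 2\<close> in auto)
    then have approx: "cmod (integral {-R..R} (\<lambda>t. f (of_real t) * damp R (of_real t) * k (of_real t)) - I) \<le> 72 * M"
      using \<open>R \<ge> 2\<close> by simp
    have "cmod I \<le> 4 * (2 * M * (5 / 4))"
    proof -
      have "cmod (f \<i>) \<le> 2 * M"
        using growth[of \<i>] by simp
      moreover have "cmod (damp R \<i>) \<le> 5 / 4"
      proof -
        have "R\<^sup>2 \<ge> 2\<^sup>2"
          using \<open>R \<ge> 2\<close> by (intro power_mono) auto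
        then have "1 / R\<^sup>2 \<le> 1 / 4"
          by (intro divide_left_mono) auto
        moreover have "damp R \<i> = of_real (1 + 1 / R\<^sup>2)"
          by (simp add: damp_def)
        moreover have "0 \<le> 1 / R\<^sup>2"
          by simp
        ultimately show ?thesis
          by (simp only: norm_of_real)
      qed
      ultimately show ?thesis
        unfolding I_def norm_mult using pi_less_4 pi_gt_zero \<open>M \<ge> 0\<close>
        by (intro mult_mono) auto
    qed
    then have "cmod (integral {-R..R} (\<lambda>t. f (of_real t) * damp R (of_real t) * k (of_real t))) \<le> 100 * M"
      using approx \<open>M \<ge> 0\<close> norm_triangle_ineq2[of "integral {-R..R} (\<lambda>t. f (of_real t) * damp R (of_real t) * k (of_real t))" I]
      by linarith
    moreover have "integral {-R..R} (u n)
        = Im (integral {-R..R} (\<lambda>t. f (of_real t) * damp R (of_real t) * k (of_real t)))"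
      using integral_linear[OF integrable_continuous_interval[OF cont] bounded_linear_Im, of "-R" R n]
      by (simp add: o_def u_eq[abs_def] R_def)
    ultimately show ?thesis
      using abs_Im_le_cmod[of "integral {-R..R} (\<lambda>t. f (of_real t) * damp R (of_real t) * k (of_real t))"]
      by (simp add: R_def)
  qed
  have "(\<integral>\<^sup>+ t. ennreal (Im (f (of_real t)) / (1 + t\<^sup>2)) \<partial>lborel)
      = (\<integral>\<^sup>+ t. liminf (\<lambda>n. ennreal (v n t)) \<partial>lborel)"
  proof (intro nn_integral_cong)
    fix t :: real
    have "eventually (\<lambda>n. u n t = v n t) sequentially"
      using eventually_ge_at_top[of "nat \<lceil>\<bar>t\<bar>\<rceil>"]
      by eventually_elim (auto simp: v_def indicator_def abs_le_iff nat_ceiling_le_eq)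
    moreover have "(\<lambda>n. u n t) \<longlonglongrightarrow> Im (f (of_real t)) / (1 + t\<^sup>2)"
    proof -
      have "(\<lambda>n. 1 - t\<^sup>2 / (real n)\<^sup>2) \<longlonglongrightarrow> 1"
        by real_asymp
      from tendsto_mult[OF tendsto_const this, of "Im (f (of_real t)) / (1 + t\<^sup>2)"]
      show ?thesis
        unfolding u_def by simp
    qed
    ultimately have "(\<lambda>n. v n t) \<longlonglongrightarrow> Im (f (of_real t)) / (1 + t\<^sup>2)"
      by (rule Lim_transform_eventually[rotated])
    from lim_imp_Liminf[OF _ tendsto_ennrealI[OF this]]
    show "ennreal (Im (f (of_real t)) / (1 + t\<^sup>2)) = liminf (\<lambda>n. ennreal (v n t))"
      by simp
  qed
  also have "\<dots> \<le> liminf (\<lambda>n. \<integral>\<^sup>+ t. ennreal (v n t) \<partial>lborel)"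
  proof (rule nn_integral_liminf)
    have "u n \<in> borel_measurable borel" for n
      by (intro borel_measurable_continuous_onI contu)
    then show "(\<lambda>t. ennreal (v n t)) \<in> borel_measurable lborel" for n
      unfolding v_def by measurable
  qed
  also have "\<dots> \<le> ennreal (100 * M)"
  proof -
    have "(\<integral>\<^sup>+ t. ennreal (v n t) \<partial>lborel) = ennreal (integral {- real n..real n} (u n))" for n
      unfolding v_def
      by (rule nn_integral_has_integral_lebesgue[OF u_nonneg])
        (use integrable_integral[OF integrable_continuous_interval[OF contu]] in auto)
    then have "eventually (\<lambda>n. (\<integral>\<^sup>+ t. ennreal (v n t) \<partial>lborel) \<le> ennreal (100 * M)) sequentially"
      using bound by (intro eventually_sequentiallyI[of 2]) (auto intro: ennreal_leI)
    then show ?thesis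
      using Liminf_le[of sequentially "\<lambda>n. \<integral>\<^sup>+ t. ennreal (v n t) \<partial>lborel" "ennreal (100 * M)"]
      by simp
  qed
  finally show ?thesis .
qed

lemma herglotz_growth:
  assumes "herglotz h"
  shows "\<exists>M\<ge>0. \<forall>z\<in>- \<real>. cmod (h z) \<le> M * ((1 + (cmod z)\<^sup>2) / \<bar>Im z\<bar>)"
proof (intro exI conjI ballI)
  let ?M = "1 + 2 * cmod (h \<i> + \<i>)"
  have h: "h holomorphic_on - \<real>" "\<And>z. z \<in> - \<real> \<Longrightarrow> Im (h z) / Im z \<ge> 0"
    "\<And>z. z \<in> - \<real> \<Longrightarrow> h (cnj z) = cnj (h z)"
    using assms by (auto simp: herglotz_def)
  have up: "cmod (h z) \<le> ?M * ((1 + (cmod z)\<^sup>2) / Im z)" if "Im z > 0" for z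
  proof (rule upper_half_plane_growth[OF _ _ that])
    show "h holomorphic_on {s. Im s > 0}"
      by (rule holomorphic_on_subset[OF h(1)]) (auto simp: complex_is_Real_iff)
    show "Im (h s) \<ge> 0" if "Im s > 0" for s
      using h(2)[of s] that by (simp add: complex_is_Real_iff zero_le_divide_iff)
  qed
  fix z :: complex assume z: "z \<in> - \<real>"
  show "cmod (h z) \<le> ?M * ((1 + (cmod z)\<^sup>2) / \<bar>Im z\<bar>)"
  proof (cases "Im z > 0")
    case True
    then show ?thesis
      using up by simp
  next
    case False
    then have "Im (cnj z) > 0"
      using z by (auto simp: complex_is_Real_iff)
    from up[OF this] show ?thesis
      using h(3)[OF z] \<open>Im (cnj z) > 0\<close> by simp
  qed
qed auto

text \<open>By symmetry the jump of a Herglotz function is \<open>2 \<i> Im (h (t + \<i> r))\<close>.\<close>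

lemma herglotz_jump_integral_bounded:
  assumes "herglotz h"
  shows "\<exists>C::real. \<forall>r\<in>{0<..<1}. (\<integral>\<^sup>+ t. ennreal (cmod (jump h r t) / (1 + t\<^sup>2)) \<partial>lborel) \<le> ennreal C"
proof -
  have h: "h holomorphic_on - \<real>" "\<And>z. z \<in> - \<real> \<Longrightarrow> Im (h z) / Im z \<ge> 0"
    "\<And>z. z \<in> - \<real> \<Longrightarrow> h (cnj z) = cnj (h z)"
    using assms by (auto simp: herglotz_def)
  obtain M where M: "M \<ge> 0" "\<And>z. z \<in> - \<real> \<Longrightarrow> cmod (h z) \<le> M * ((1 + (cmod z)\<^sup>2) / \<bar>Im z\<bar>)"
    using herglotz_growth[OF assms] by blast
  have "(\<integral>\<^sup>+ t. ennreal (cmod (jump h r t) / (1 + t\<^sup>2)) \<partial>lborel) \<le> ennreal (2 * (100 * (3 * M)))"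
    if r: "r \<in> {0<..<1}" for r
  proof -
    define f where "f = (\<lambda>s. h (s + \<i> * of_real r))"
    have im: "Im (f (of_real t)) \<ge> 0" for t
      using h(2)[of "of_real t + \<i> * of_real r"] r by (simp add: f_def complex_is_Real_iff zero_le_divide_iff)
    have jump: "cmod (jump h r t) = 2 * Im (f (of_real t))" for t
    proof -
      have "Complex t r = of_real t + \<i> * of_real r" "Complex t (- r) = cnj (Complex t r)"
        by (simp_all add: complex_eq_iff)
      moreover have "h (cnj (Complex t r)) = cnj (h (Complex t r))"
        using r by (intro h(3)) (auto simp: complex_is_Real_iff)
      ultimately have "jump h r t = f (of_real t) - cnj (f (of_real t))"
        by (simp add: f_def)
      also have "\<dots> = of_real (2 * Im (f (of_real t))) * \<i>"
        by (simp add: complex_eq_iff)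
      finally show ?thesis
        using im[of t] by (simp add: norm_mult)
    qed
    have "(\<integral>\<^sup>+ t. ennreal (cmod (jump h r t) / (1 + t\<^sup>2)) \<partial>lborel)
        = (\<integral>\<^sup>+ t. 2 * ennreal (Im (f (of_real t)) / (1 + t\<^sup>2)) \<partial>lborel)"
      unfolding jump by (intro nn_integral_cong)
        (simp add: ennreal_mult'[symmetric] ennreal_numeral[symmetric] del: ennreal_numeral)
    also have "\<dots> = 2 * (\<integral>\<^sup>+ t. ennreal (Im (f (of_real t)) / (1 + t\<^sup>2)) \<partial>lborel)"
    proof (rule nn_integral_cmult)
      have "continuous_on UNIV (\<lambda>t. h (complex_of_real t + \<i> * of_real r))"
        by (rule continuous_on_compose2[OF holomorphic_on_imp_continuous_on[OF h(1)]])
          (use r in \<open>auto intro!: continuous_intros simp: complex_is_Real_iff\<close>)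
      then have "continuous_on UNIV (\<lambda>t. Im (f (of_real t)) / (1 + t\<^sup>2))"
        unfolding f_def by (intro continuous_intros) (auto simp: add_nonneg_eq_0_iff)
      then show "(\<lambda>t. ennreal (Im (f (of_real t)) / (1 + t\<^sup>2))) \<in> borel_measurable lborel"
        unfolding measurable_lborel2
        by (rule measurable_compose[OF borel_measurable_continuous_onI measurable_ennreal])
    qed
    also have "\<dots> \<le> 2 * ennreal (100 * (3 * M))"
    proof (intro mult_left_mono nn_integral_Im_boundary_le)
      show "f holomorphic_on {s. Im s > - r}"
        unfolding f_def
        by (rule holomorphic_on_compose_gen[OF _ h(1), unfolded o_def])
          (auto intro!: holomorphic_intros simp: complex_is_Real_iff)
      show "cmod (f s) \<le> 3 * M * (1 + (cmod s)\<^sup>2) / Im s" if "Im s > 0" for s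
        unfolding f_def by (rule growth_shift[OF M(2)]) (use that r M(1) in auto)
    qed (use r M(1) im in auto)
    also have "\<dots> = ennreal (2 * (100 * (3 * M)))"
      by (simp add: ennreal_mult'[symmetric] ennreal_numeral[symmetric] del: ennreal_numeral)
    finally show ?thesis .
  qed
  then show ?thesis
    by blast
qed

lemma quasi_herglotz_growth_and_jump:
  assumes "quasi_herglotz q"
  shows "\<exists>M::real. M \<ge> 0 \<and> (\<forall>z\<in>- \<real>. cmod (q z) \<le> M * ((1 + (cmod z)\<^sup>2) / \<bar>Im z\<bar>))"
    and "(SUP r\<in>{0<..<1::real}.
       \<integral>\<^sup>+ t. ennreal (cmod (jump q r t) / (1 + t\<^sup>2)) \<partial>lborel) < \<infinity>"
proof -
  obtain h1 h2 h3 h4 where h: "herglotz h1" "herglotz h2" "herglotz h3" "herglotz h4"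
    and q: "\<And>z. z \<in> - \<real> \<Longrightarrow> q z = (h1 z - h2 z) + \<i> * (h3 z - h4 z)"
    using assms by (auto simp: quasi_herglotz_def)
  have norm4: "cmod ((a - b) + \<i> * (c - d)) \<le> cmod a + cmod b + cmod c + cmod d" for a b c d
    using norm_triangle_ineq[of "a - b" "\<i> * (c - d)"] norm_triangle_ineq4[of a b] norm_triangle_ineq4[of c d]
    by (simp add: norm_mult)
  obtain M1 where M1: "M1 \<ge> 0" "\<And>z. z \<in> - \<real> \<Longrightarrow> cmod (h1 z) \<le> M1 * ((1 + (cmod z)\<^sup>2) / \<bar>Im z\<bar>)"
    using herglotz_growth[OF h(1)] by blast
  obtain M2 where M2: "M2 \<ge> 0" "\<And>z. z \<in> - \<real> \<Longrightarrow> cmod (h2 z) \<le> M2 * ((1 + (cmod z)\<^sup>2) / \<bar>Im z\<bar>)"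
    using herglotz_growth[OF h(2)] by blast
  obtain M3 where M3: "M3 \<ge> 0" "\<And>z. z \<in> - \<real> \<Longrightarrow> cmod (h3 z) \<le> M3 * ((1 + (cmod z)\<^sup>2) / \<bar>Im z\<bar>)"
    using herglotz_growth[OF h(3)] by blast
  obtain M4 where M4: "M4 \<ge> 0" "\<And>z. z \<in> - \<real> \<Longrightarrow> cmod (h4 z) \<le> M4 * ((1 + (cmod z)\<^sup>2) / \<bar>Im z\<bar>)"
    using herglotz_growth[OF h(4)] by blast
  show "\<exists>M::real. M \<ge> 0 \<and> (\<forall>z\<in>- \<real>. cmod (q z) \<le> M * ((1 + (cmod z)\<^sup>2) / \<bar>Im z\<bar>))"
  proof (intro exI[of _ "M1 + M2 + M3 + M4"] conjI ballI)
    fix z :: complex assume z: "z \<in> - \<real>"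
    show "cmod (q z) \<le> (M1 + M2 + M3 + M4) * ((1 + (cmod z)\<^sup>2) / \<bar>Im z\<bar>)"
      unfolding q[OF z] distrib_right
      by (intro order.trans[OF norm4] add_mono M1 M2 M3 M4 z)
  qed (use M1 M2 M3 M4 in simp)
  obtain C1 :: real where C1:
    "\<forall>r\<in>{0<..<1}. (\<integral>\<^sup>+ t. ennreal (cmod (jump h1 r t) / (1 + t\<^sup>2)) \<partial>lborel) \<le> ennreal C1"
    using herglotz_jump_integral_bounded[OF h(1)] by blast
  obtain C2 :: real where C2:
    "\<forall>r\<in>{0<..<1}. (\<integral>\<^sup>+ t. ennreal (cmod (jump h2 r t) / (1 + t\<^sup>2)) \<partial>lborel) \<le> ennreal C2"
    using herglotz_jump_integral_bounded[OF h(2)] by blast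
  obtain C3 :: real where C3:
    "\<forall>r\<in>{0<..<1}. (\<integral>\<^sup>+ t. ennreal (cmod (jump h3 r t) / (1 + t\<^sup>2)) \<partial>lborel) \<le> ennreal C3"
    using herglotz_jump_integral_bounded[OF h(3)] by blast
  obtain C4 :: real where C4:
    "\<forall>r\<in>{0<..<1}. (\<integral>\<^sup>+ t. ennreal (cmod (jump h4 r t) / (1 + t\<^sup>2)) \<partial>lborel) \<le> ennreal C4"
    using herglotz_jump_integral_bounded[OF h(4)] by blast
  have meas: "(\<lambda>t. ennreal (cmod (jump h r t) / (1 + t\<^sup>2))) \<in> borel_measurable lborel"
    if "herglotz h" "0 < r" for h r
  proof -
    have "continuous_on UNIV (\<lambda>t. h (Complex t c))" if "c \<noteq> 0" for c
      using \<open>herglotz h\<close> that by (intro continuous_on_horizontal_line) (auto simp: herglotz_def)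
    then have "continuous_on UNIV (\<lambda>t. cmod (jump h r t) / (1 + t\<^sup>2))"
      using \<open>0 < r\<close> by (intro continuous_intros) (auto simp: add_nonneg_eq_0_iff)
    then show ?thesis
      unfolding measurable_lborel2
      by (rule measurable_compose[OF borel_measurable_continuous_onI measurable_ennreal])
  qed
  have "(\<integral>\<^sup>+ t. ennreal (cmod (jump q r t) / (1 + t\<^sup>2)) \<partial>lborel)
      \<le> ennreal C1 + ennreal C2 + ennreal C3 + ennreal C4" if r: "r \<in> {0<..<1}" for r
  proof -
    note meas = meas[OF h(1), of r] meas[OF h(2), of r] meas[OF h(3), of r] meas[OF h(4), of r]
    have "(\<integral>\<^sup>+ t. ennreal (cmod (jump q r t) / (1 + t\<^sup>2)) \<partial>lborel)
      \<le> (\<integral>\<^sup>+ t. ennreal (cmod (jump h1 r t) / (1 + t\<^sup>2)) + ennreal (cmod (jump h2 r t) / (1 + t\<^sup>2))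
          + ennreal (cmod (jump h3 r t) / (1 + t\<^sup>2)) + ennreal (cmod (jump h4 r t) / (1 + t\<^sup>2)) \<partial>lborel)"
    proof (rule nn_integral_mono)
      fix t :: real
      have "Complex t r \<in> - \<real>" "Complex t (- r) \<in> - \<real>"
        using r by (auto simp: complex_is_Real_iff)
      then have eq: "jump q r t = (jump h1 r t - jump h2 r t) + \<i> * (jump h3 r t - jump h4 r t)"
        by (simp add: q algebra_simps)
      have "cmod (jump q r t) \<le> cmod (jump h1 r t) + cmod (jump h2 r t) + cmod (jump h3 r t) + cmod (jump h4 r t)"
        unfolding eq by (rule norm4)
      then have "cmod (jump q r t) / (1 + t\<^sup>2) \<le>
          (cmod (jump h1 r t) + cmod (jump h2 r t) + cmod (jump h3 r t) + cmod (jump h4 r t)) / (1 + t\<^sup>2)"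
        by (intro divide_right_mono) auto
      then show "ennreal (cmod (jump q r t) / (1 + t\<^sup>2)) \<le>
          ennreal (cmod (jump h1 r t) / (1 + t\<^sup>2)) + ennreal (cmod (jump h2 r t) / (1 + t\<^sup>2))
          + ennreal (cmod (jump h3 r t) / (1 + t\<^sup>2)) + ennreal (cmod (jump h4 r t) / (1 + t\<^sup>2))"
        by (simp add: ennreal_plus[symmetric] add_divide_distrib del: ennreal_plus)
    qed
    also have "\<dots> \<le> ennreal C1 + ennreal C2 + ennreal C3 + ennreal C4"
    proof -
      have "(\<integral>\<^sup>+ t. ennreal (cmod (jump h1 r t) / (1 + t\<^sup>2)) + ennreal (cmod (jump h2 r t) / (1 + t\<^sup>2))
          + ennreal (cmod (jump h3 r t) / (1 + t\<^sup>2)) + ennreal (cmod (jump h4 r t) / (1 + t\<^sup>2)) \<partial>lborel)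
        = (\<integral>\<^sup>+ t. ennreal (cmod (jump h1 r t) / (1 + t\<^sup>2)) \<partial>lborel)
          + (\<integral>\<^sup>+ t. ennreal (cmod (jump h2 r t) / (1 + t\<^sup>2)) \<partial>lborel)
          + (\<integral>\<^sup>+ t. ennreal (cmod (jump h3 r t) / (1 + t\<^sup>2)) \<partial>lborel)
          + (\<integral>\<^sup>+ t. ennreal (cmod (jump h4 r t) / (1 + t\<^sup>2)) \<partial>lborel)"
        using r by (subst nn_integral_add; (intro borel_measurable_add meas)?; simp)+
      then show ?thesis
        using bspec[OF C1 r] bspec[OF C2 r] bspec[OF C3 r] bspec[OF C4 r]
        by (simp only: add_mono)
    qed
    finally show ?thesis .
  qed
  then have "(SUP r\<in>{0<..<1::real}. \<integral>\<^sup>+ t. ennreal (cmod (jump q r t) / (1 + t\<^sup>2)) \<partial>lborel)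
      \<le> ennreal C1 + ennreal C2 + ennreal C3 + ennreal C4"
    by (rule SUP_least)
  then show "(SUP r\<in>{0<..<1::real}. \<integral>\<^sup>+ t. ennreal (cmod (jump q r t) / (1 + t\<^sup>2)) \<partial>lborel) < \<infinity>"
    by (rule order.strict_trans1) simp
qed

section \<open>Representation by the jump\<close>

lemma integral_reflect_symmetric:
  fixes g :: "real \<Rightarrow> complex"
  shows "integral {-a..a} (\<lambda>t. g (- t)) = integral {-a..a} g"
  using Henstock_Kurzweil_Integration.integral_reflect_real[of a "-a" g] by simp

lemma norm_real_minus_ge: "cmod (of_real t - z) \<ge> \<bar>Im z\<bar>"
  using abs_Im_le_cmod[of "of_real t - z"] by simp

lemma integral_tendsto_LBINT:
  fixes F :: "real \<Rightarrow> complex" and w :: "nat \<Rightarrow> real \<Rightarrow> complex"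
  assumes F: "integrable lborel F" and contF: "continuous_on UNIV F"
    and w: "\<And>n. continuous_on UNIV (w n)" "\<And>t n. \<bar>t\<bar> \<le> real n \<Longrightarrow> cmod (w n t) \<le> 1"
      "\<And>t. (\<lambda>n. w n t) \<longlonglongrightarrow> 1"
  shows "(\<lambda>n. integral {- real n..real n} (\<lambda>t. F t * w n t)) \<longlonglongrightarrow> (LINT t|lborel. F t)"
proof -
  let ?G = "\<lambda>n t. indicator {- real n..real n} t *\<^sub>R (F t * w n t)"
  have meas: "?G n \<in> borel_measurable borel" for n
  proof -
    have "continuous_on UNIV (\<lambda>t. F t * w n t)"
      by (intro continuous_on_mult contF w(1))
    then have "(\<lambda>t. F t * w n t) \<in> borel_measurable borel"
      by (rule borel_measurable_continuous_onI)
    then show ?thesis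
      by (intro borel_measurable_scaleR borel_measurable_indicator) auto
  qed
  have bound: "norm (?G n t) \<le> norm (F t)" for n t
    using w(2)[of t n] mult_left_mono[of "cmod (w n t)" 1 "cmod (F t)"]
    by (auto simp: indicator_def norm_mult)
  have "(\<lambda>n. LINT t|lborel. ?G n t) \<longlonglongrightarrow> (LINT t|lborel. F t)"
  proof (rule integral_dominated_convergence)
    show "AE t in lborel. (\<lambda>n. ?G n t) \<longlonglongrightarrow> F t"
    proof (intro AE_I2)
      fix t :: real
      have "eventually (\<lambda>n. F t * w n t = ?G n t) sequentially"
        using eventually_ge_at_top[of "nat \<lceil>\<bar>t\<bar>\<rceil>"]
        by eventually_elim (auto simp: indicator_def abs_le_iff nat_ceiling_le_eq)
      moreover have "(\<lambda>n. F t * w n t) \<longlonglongrightarrow> F t"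
        using tendsto_mult[OF tendsto_const w(3)] by simp
      ultimately show "(\<lambda>n. ?G n t) \<longlonglongrightarrow> F t"
        by (rule Lim_transform_eventually[rotated])
    qed
    show "AE t in lborel. norm (?G n t) \<le> norm (F t)" for n
      using bound by simp
  qed (use F meas in \<open>auto simp: integrable_norm borel_measurable_integrable\<close>)
  moreover have "(LINT t|lborel. ?G n t) = integral {- real n..real n} (\<lambda>t. F t * w n t)" for n
  proof -
    have "integrable lborel (?G n)"
      by (rule Bochner_Integration.integrable_bound[OF F]) (use bound meas in auto)
    then show ?thesis
      using set_borel_integral_eq_integral(2)[of "{- real n..real n}" "\<lambda>t. F t * w n t"]
      by (simp add: set_integrable_def set_lebesgue_integral_def)
  qed
  ultimately show ?thesis
    by simp
qed

text \<open>The Cauchy formula for \<open>s \<mapsto> q (s + \<i> r)\<close> and, reflected at the origin, the one for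
  \<open>s \<mapsto> q (s - \<i> r)\<close> in the lower half-plane are added. For each of them only a limit of damped integrals
  is available, since \<open>q (t \<plusminus> \<i> r)\<close> need not be integrable against \<open>1 / (1 + t\<^sup>2)\<close>; in the sum the jump
  appears, which is integrable, and dominated convergence removes the damping. Only one of the two
  Cauchy formulas sees the pole at \<open>z\<close>.\<close>

lemma jump_representation:
  fixes q :: "complex \<Rightarrow> complex"
  assumes q: "q holomorphic_on - \<real>"
    and growth: "\<And>z. z \<in> - \<real> \<Longrightarrow> cmod (q z) \<le> M * ((1 + (cmod z)\<^sup>2) / \<bar>Im z\<bar>)"
    and "M \<ge> 0" and r: "0 < r" "r < 1"
    and int: "integrable lborel (\<lambda>t. jump q r t / of_real (1 + t\<^sup>2))"
    and z: "Im z \<noteq> 0"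
  shows "away_shift q r z =
    (1 + z\<^sup>2) / (2 * pi * \<i>) * (LINT t|lborel. jump q r t / of_real (1 + t\<^sup>2) / (of_real t - z))
    + away_shift q r \<i> * (z + \<i>) / (2 * \<i>) - away_shift q r (- \<i>) * (z - \<i>) / (2 * \<i>)"
proof (cases "z = \<i> \<or> z = - \<i>")
  case True
  \<comment> \<open>At \<open>\<plusminus> \<i>\<close> the factor \<open>1 + z\<^sup>2\<close> vanishes and the identity is trivial.\<close>
  moreover have "\<i> * (w * \<i>) = - w" for w
    by (simp add: mult.commute)
  ultimately show ?thesis
    by auto
next
  case False
  define f1 where "f1 = (\<lambda>s. q (s + \<i> * of_real r))"
  define f2 where "f2 = (\<lambda>s. q (- (s + \<i> * of_real r)))"
  define K where "K = (\<lambda>t. 1 / ((complex_of_real t - z) * (1 + (of_real t)\<^sup>2)))"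
  define F where "F = (\<lambda>t. jump q r t * K t)"
  have neR: "complex_of_real t - z \<noteq> 0" for t
    using z by (metis Im_complex_of_real eq_iff_diff_eq_0)
  have ne1: "1 + (complex_of_real t)\<^sup>2 \<noteq> 0" for t
    unfolding one_plus_of_real_sq of_real_eq_0_iff using zero_le_power2[of t] by linarith
  have f1: "f1 holomorphic_on {s. Im s > - r}"
    unfolding f1_def
    by (rule holomorphic_on_compose_gen[OF _ q, unfolded o_def])
      (auto intro!: holomorphic_intros simp: complex_is_Real_iff)
  have f2: "f2 holomorphic_on {s. Im s > - r}"
    unfolding f2_def
    by (rule holomorphic_on_compose_gen[OF _ q, unfolded o_def])
      (auto intro!: holomorphic_intros simp: complex_is_Real_iff)
  have g1: "cmod (f1 s) \<le> 3 * M * (1 + (cmod s)\<^sup>2) / Im s" if "Im s > 0" for s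
    unfolding f1_def by (rule growth_shift[OF growth]) (use that r \<open>M \<ge> 0\<close> in auto)
  have g2: "cmod (f2 s) \<le> 3 * M * (1 + (cmod s)\<^sup>2) / Im s" if "Im s > 0" for s
  proof -
    have "cmod (q (- z)) \<le> M * ((1 + (cmod z)\<^sup>2) / \<bar>Im z\<bar>)" if "z \<in> - \<real>" for z
      using growth[of "- z"] that by simp
    then show ?thesis
      unfolding f2_def by (rule growth_shift) (use that r \<open>M \<ge> 0\<close> in auto)
  qed
  have L1: "(\<lambda>n. integral {- real n..real n} (\<lambda>t. f1 (of_real t) * damp (real n) (of_real t) * K t))
      \<longlonglongrightarrow> 2 * pi * \<i> * ((if Im z > 0 then f1 z else 0) / (1 + z\<^sup>2) + f1 \<i> / ((\<i> - z) * (2 * \<i>)))"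
    unfolding K_def
    by (rule damped_Cauchy_limit[OF f1 _ g1]) (use r z False \<open>M \<ge> 0\<close> in auto)
  have L2: "(\<lambda>n. integral {- real n..real n} (\<lambda>t. f2 (of_real t) * damp (real n) (of_real t) *
        (1 / ((complex_of_real t - (- z)) * (1 + (of_real t)\<^sup>2)))))
      \<longlonglongrightarrow> 2 * pi * \<i> * ((if Im (- z) > 0 then f2 (- z) else 0) / (1 + (- z)\<^sup>2)
            + f2 \<i> / ((\<i> - (- z)) * (2 * \<i>)))"
    by (rule damped_Cauchy_limit[OF f2 _ g2])
      (use r z False \<open>M \<ge> 0\<close> in \<open>auto simp: minus_equation_iff\<close>)
  have reflect: "integral {- real n..real n} (\<lambda>t. f2 (of_real t) * damp (real n) (of_real t) *
        (1 / ((complex_of_real t - (- z)) * (1 + (of_real t)\<^sup>2))))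
      = - integral {- real n..real n} (\<lambda>t. f2 (- of_real t) * damp (real n) (of_real t) * K t)" for n
  proof -
    have eq: "f2 (of_real (- t)) * damp (real n) (of_real (- t)) *
        (1 / ((complex_of_real (- t) - (- z)) * (1 + (of_real (- t))\<^sup>2)))
      = - (f2 (- of_real t) * damp (real n) (of_real t) * K t)" for t
    proof -
      have "(complex_of_real (- t) - (- z)) * (1 + (of_real (- t))\<^sup>2)
          = - ((complex_of_real t - z) * (1 + (of_real t)\<^sup>2))"
        by (simp add: algebra_simps)
      then show ?thesis
        by (simp add: K_def)
    qed
    show ?thesis
      by (subst integral_reflect_symmetric[symmetric]) (simp only: eq integral_neg)
  qed
  note cont = continuous_on_horizontal_line[OF q]
  have contK: "continuous_on A K" for A
    unfolding K_def by (intro continuous_intros) (use neR ne1 in auto)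
  have f12: "f1 (of_real t) = q (Complex t r)" "f2 (- of_real t) = q (Complex t (- r))" for t
    by (simp_all add: f1_def f2_def Complex_eq)
  have intgr: "(\<lambda>t. q (Complex t c) * damp (real n) (of_real t) * K t) integrable_on {- real n..real n}"
    if "c \<noteq> 0" for c n
    by (intro integrable_continuous_interval continuous_intros cont contK that)
  have sum: "integral {- real n..real n} (\<lambda>t. F t * damp (real n) (of_real t))
      = integral {- real n..real n} (\<lambda>t. f1 (of_real t) * damp (real n) (of_real t) * K t)
      + integral {- real n..real n} (\<lambda>t. f2 (of_real t) * damp (real n) (of_real t) *
        (1 / ((complex_of_real t - (- z)) * (1 + (of_real t)\<^sup>2))))" for n
    unfolding reflect f12 F_def using intgr[of r n] intgr[of "- r" n] r
    by (simp add: integral_diff[symmetric] algebra_simps)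
  have "(\<lambda>n. integral {- real n..real n} (\<lambda>t. F t * damp (real n) (of_real t)))
      \<longlonglongrightarrow> (LINT t|lborel. F t)"
  proof (rule integral_tendsto_LBINT)
    show "continuous_on UNIV F"
      unfolding F_def by (intro continuous_intros cont contK) (use r in auto)
    then have "F \<in> borel_measurable lborel"
      by (simp add: borel_measurable_continuous_onI)
    moreover have "norm (F t) \<le> norm (1 / \<bar>Im z\<bar> * (jump q r t / of_real (1 + t\<^sup>2)))" for t
    proof -
      have "F t = jump q r t / of_real (1 + t\<^sup>2) * (1 / (of_real t - z))"
        by (simp add: F_def K_def)
      moreover have "1 / cmod (of_real t - z) \<le> 1 / \<bar>Im z\<bar>"
        using norm_real_minus_ge[of z t] z by (intro divide_left_mono mult_pos_pos) auto
      ultimately show ?thesis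
        using mult_left_mono[of "1 / cmod (of_real t - z)" "1 / \<bar>Im z\<bar>" "norm (jump q r t / of_real (1 + t\<^sup>2))"]
        by (simp add: norm_mult norm_divide mult.commute)
    qed
    ultimately show "integrable lborel F"
      by (intro Bochner_Integration.integrable_bound[OF integrable_mult_right[OF int, of "1 / \<bar>Im z\<bar>"]]) auto
    show "continuous_on UNIV (\<lambda>t. damp (real n) (of_real t))" for n
      by (intro continuous_intros)
    show "cmod (damp (real n) (of_real t)) \<le> 1" if "\<bar>t\<bar> \<le> real n" for t n
    proof -
      have "t\<^sup>2 \<le> (real n)\<^sup>2"
        using that by (simp add: abs_le_square_iff[symmetric])
      then have "t\<^sup>2 / (real n)\<^sup>2 \<le> 1"
        by (auto simp: divide_le_eq_1)
      moreover have "t\<^sup>2 / (real n)\<^sup>2 \<ge> 0"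
        by simp
      ultimately show ?thesis
        unfolding damp_of_real norm_of_real by linarith
    qed
    show "(\<lambda>n. damp (real n) (of_real t)) \<longlonglongrightarrow> 1" for t
    proof -
      have "(\<lambda>n. complex_of_real (1 - t\<^sup>2 / (real n)\<^sup>2)) \<longlonglongrightarrow> of_real 1"
        by (rule tendsto_of_real) real_asymp
      then show ?thesis
        by (simp only: damp_of_real of_real_1)
    qed
  qed
  \<comment> \<open>The dominated limit and the sum of the two Cauchy limits belong to the same sequence.\<close>
  from LIMSEQ_unique[OF this, unfolded sum, OF tendsto_add[OF L1 L2]]
  have "(LINT t|lborel. F t) = 2 * pi * \<i> * (away_shift q r z / (1 + z\<^sup>2)
      + away_shift q r \<i> / ((\<i> - z) * (2 * \<i>)) + away_shift q r (- \<i>) / ((\<i> + z) * (2 * \<i>)))"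
    using z by (cases "Im z > 0") (simp_all add: f1_def f2_def algebra_simps)
  moreover have "F = (\<lambda>t. jump q r t / of_real (1 + t\<^sup>2) / (of_real t - z))"
    by (auto simp: F_def K_def fun_eq_iff mult.commute)
  moreover have "1 + z\<^sup>2 = (z - \<i>) * (z + \<i>)"
    by (simp add: algebra_simps power2_eq_square)
  moreover have "U = a * b / c * (c * (U / (a * b) + P / (- a * d) + Q / (b * d))) + P * b / d - Q * a / d"
    if "a \<noteq> 0" "b \<noteq> 0" "c \<noteq> 0" "d \<noteq> 0" for a b c d P Q U :: complex
    using that by (simp add: field_simps)
  from this[of "z - \<i>" "z + \<i>" "2 * pi * \<i>" "2 * \<i>" "away_shift q r z" "away_shift q r \<i>" "away_shift q r (- \<i>)"]
  have "away_shift q r z = (z - \<i>) * (z + \<i>) / (2 * pi * \<i>) * (2 * pi * \<i> * (away_shift q r z / ((z - \<i>) * (z + \<i>))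
      + away_shift q r \<i> / ((\<i> - z) * (2 * \<i>)) + away_shift q r (- \<i>) / ((\<i> + z) * (2 * \<i>))))
      + away_shift q r \<i> * (z + \<i>) / (2 * \<i>) - away_shift q r (- \<i>) * (z - \<i>) / (2 * \<i>)"
    using False by (simp add: eq_neg_iff_add_eq_0 add.commute)
  ultimately show ?thesis
    by simp
qed

section \<open>Nevanlinna transforms and limits of Herglotz functions\<close>

text \<open>The kernel of the Nevanlinna integral representation of Herglotz functions; the weight
  \<open>1 / (1 + t\<^sup>2)\<close> will be part of the density.\<close>

definition nev_kernel :: "real \<Rightarrow> complex \<Rightarrow> complex" where
  "nev_kernel t z = (1 + of_real t * z) / (of_real t - z)"

definition nev_transform :: "(real \<Rightarrow> complex) \<Rightarrow> complex \<Rightarrow> complex" where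
  "nev_transform g z = (LINT t|lborel. g t * nev_kernel t z)"

lemma real_minus_nonreal_nonzero: "z \<in> - \<real> \<Longrightarrow> complex_of_real t - z \<noteq> 0"
  by (metis ComplD Reals_of_real eq_iff_diff_eq_0)

lemma nev_kernel_decomp:
  assumes "z \<in> - \<real>"
  shows "nev_kernel t z = (1 + z\<^sup>2) / (of_real t - z) + z"
  unfolding nev_kernel_def using real_minus_nonreal_nonzero[OF assms, of t]
  by (simp add: field_simps power2_eq_square)

lemma Im_nev_kernel:
  "Im (nev_kernel t z) = Im z * ((1 + t\<^sup>2) / (cmod (of_real t - z))\<^sup>2)"
  unfolding nev_kernel_def cmod_power2 Im_divide by (simp add: algebra_simps power2_eq_square)

lemma cnj_nev_kernel: "cnj (nev_kernel t z) = nev_kernel t (cnj z)"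
  by (simp add: nev_kernel_def)

lemma norm_nev_kernel_le:
  assumes z: "z \<in> - \<real>"
  shows "cmod (nev_kernel t z) \<le> 2 * ((1 + (cmod z)\<^sup>2) / \<bar>Im z\<bar>)"
proof -
  have y: "\<bar>Im z\<bar> > 0"
    using z by (simp add: complex_is_Real_iff)
  have "cmod ((1 + z\<^sup>2) / (of_real t - z)) \<le> (1 + (cmod z)\<^sup>2) / \<bar>Im z\<bar>"
    unfolding norm_divide using norm_triangle_ineq[of 1 "z\<^sup>2"] norm_real_minus_ge[of z t] y
    by (intro frac_le) (auto simp: norm_power)
  moreover have "cmod z \<le> (1 + (cmod z)\<^sup>2) / \<bar>Im z\<bar>"
  proof -
    have "cmod z * \<bar>Im z\<bar> \<le> cmod z * cmod z"
      by (intro mult_left_mono abs_Im_le_cmod) auto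
    then show ?thesis
      using y by (simp add: pos_le_divide_eq power2_eq_square)
  qed
  ultimately show ?thesis
    unfolding nev_kernel_decomp[OF z] using norm_triangle_ineq[of "(1 + z\<^sup>2) / (of_real t - z)" z]
    by linarith
qed

lemma continuous_nev_kernel: "z \<in> - \<real> \<Longrightarrow> continuous_on UNIV (\<lambda>t. nev_kernel t z)"
  unfolding nev_kernel_def using real_minus_nonreal_nonzero by (intro continuous_intros) auto

lemma integrable_nev_kernel:
  assumes g: "integrable lborel g" and z: "z \<in> - \<real>"
  shows "integrable lborel (\<lambda>t. g t * nev_kernel t z)"
proof (rule Bochner_Integration.integrable_bound)
  show "integrable lborel (\<lambda>t. (2 * ((1 + (cmod z)\<^sup>2) / \<bar>Im z\<bar>)) * norm (g t))"
    by (intro integrable_mult_right integrable_norm g)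
  show "(\<lambda>t. g t * nev_kernel t z) \<in> borel_measurable lborel"
    using borel_measurable_integrable[OF g] borel_measurable_continuous_onI[OF continuous_nev_kernel[OF z]]
    by simp
  show "AE t in lborel. norm (g t * nev_kernel t z) \<le> norm ((2 * ((1 + (cmod z)\<^sup>2) / \<bar>Im z\<bar>)) * norm (g t))"
  proof (rule AE_I2)
    fix t
    show "norm (g t * nev_kernel t z) \<le> norm ((2 * ((1 + (cmod z)\<^sup>2) / \<bar>Im z\<bar>)) * norm (g t))"
      using mult_right_mono[OF norm_nev_kernel_le[OF z, of t], of "norm (g t)"]
      by (simp add: norm_mult abs_mult mult.commute)
  qed
qed

lemma norm_nev_transform_le:
  assumes g: "integrable lborel g" and z: "z \<in> - \<real>"
  shows "cmod (nev_transform g z) \<le> (LINT t|lborel. cmod (g t)) * (2 * ((1 + (cmod z)\<^sup>2) / \<bar>Im z\<bar>))"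
proof -
  have "cmod (nev_transform g z) \<le> (LINT t|lborel. cmod (g t * nev_kernel t z))"
    unfolding nev_transform_def by (rule integral_norm_bound)
  also have "\<dots> \<le> (LINT t|lborel. cmod (g t) * (2 * ((1 + (cmod z)\<^sup>2) / \<bar>Im z\<bar>)))"
  proof (rule integral_mono)
    show "integrable lborel (\<lambda>t. cmod (g t * nev_kernel t z))"
      by (intro integrable_norm integrable_nev_kernel g z)
    show "integrable lborel (\<lambda>t. cmod (g t) * (2 * ((1 + (cmod z)\<^sup>2) / \<bar>Im z\<bar>)))"
      by (intro integrable_mult_left integrable_norm g)
    show "cmod (g t * nev_kernel t z) \<le> cmod (g t) * (2 * ((1 + (cmod z)\<^sup>2) / \<bar>Im z\<bar>))" for t
      unfolding norm_mult by (intro mult_left_mono norm_nev_kernel_le z) auto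
  qed
  finally show ?thesis
    by simp
qed

lemma nev_kernel_difference:
  assumes "z \<in> - \<real>" "w \<in> - \<real>" "w \<noteq> z"
  shows "(nev_kernel t w - nev_kernel t z) / (w - z) = (1 + (of_real t)\<^sup>2) / ((of_real t - w) * (of_real t - z))"
  unfolding nev_kernel_def
  using real_minus_nonreal_nonzero[OF assms(1), of t] real_minus_nonreal_nonzero[OF assms(2), of t] assms(3)
  by (simp add: divide_simps) (simp add: algebra_simps power2_eq_square)

lemma nev_weight_le:
  assumes z: "z \<in> - \<real>"
  shows "(1 + t\<^sup>2) / (cmod (of_real t - z))\<^sup>2 \<le> 2 * ((1 + (cmod z)\<^sup>2) / \<bar>Im z\<bar>) / \<bar>Im z\<bar>"
proof -
  have y: "\<bar>Im z\<bar> > 0"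
    using z by (simp add: complex_is_Real_iff)
  have "(1 + t\<^sup>2) / (cmod (of_real t - z))\<^sup>2 * \<bar>Im z\<bar> = \<bar>Im (nev_kernel t z)\<bar>"
    unfolding Im_nev_kernel abs_mult by simp
  also have "\<dots> \<le> 2 * ((1 + (cmod z)\<^sup>2) / \<bar>Im z\<bar>)"
    using abs_Im_le_cmod norm_nev_kernel_le[OF z] by (rule order_trans)
  finally show ?thesis
    using y by (simp only: pos_le_divide_eq)
qed

text \<open>Difference quotients converge under the integral sign: those of the kernel are
  \<open>(1 + t\<^sup>2) / ((t - w) (t - z))\<close>, and the inequality \<open>x y \<le> (x\<^sup>2 + y\<^sup>2) / 2\<close> bounds them by the diagonal
  values \<open>(1 + t\<^sup>2) / \<bar>t - z\<bar>\<^sup>2\<close>, each of which is \<open>Im (nev_kernel t z) / Im z\<close>.\<close>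

lemma holomorphic_nev_transform:
  assumes g: "integrable lborel g"
  shows "nev_transform g holomorphic_on - \<real>"
  unfolding holomorphic_on_def field_differentiable_def has_field_derivative_iff
proof (intro ballI exI)
  fix z :: complex assume z: "z \<in> - \<real>"
  let ?k = "\<lambda>w t. (1 + (complex_of_real t)\<^sup>2) / ((of_real t - w) * (of_real t - z))"
  let ?B = "\<lambda>w. 2 * ((1 + (cmod w)\<^sup>2) / \<bar>Im w\<bar>) / \<bar>Im w\<bar>"
  have meas: "?k w \<in> borel_measurable borel" if "w \<in> - \<real>" for w
    using real_minus_nonreal_nonzero[OF z] real_minus_nonreal_nonzero[OF that]
    by (intro borel_measurable_continuous_onI continuous_intros) auto
  have bound: "cmod (?k w t) \<le> (?B w + ?B z) / 2" if w: "w \<in> - \<real>" for w t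
  proof -
    have ge: "x * y \<le> (x\<^sup>2 + y\<^sup>2) / 2" for x y :: real
      using zero_le_power2[of "x - y"] by (simp add: power2_eq_square algebra_simps)
    have pos: "1 + t\<^sup>2 > 0"
      using zero_le_power2[of t] by linarith
    let ?p = "1 / cmod (of_real t - w)" and ?q = "1 / cmod (of_real t - z)"
    have "cmod (?k w t) = (1 + t\<^sup>2) * (?p * ?q)"
      unfolding one_plus_of_real_sq norm_divide norm_mult norm_of_real using pos by simp
    also have "\<dots> \<le> (1 + t\<^sup>2) * ((?p\<^sup>2 + ?q\<^sup>2) / 2)"
      using pos by (intro mult_left_mono ge) simp
    also have "\<dots> = ((1 + t\<^sup>2) / (cmod (of_real t - w))\<^sup>2 + (1 + t\<^sup>2) / (cmod (of_real t - z))\<^sup>2) / 2"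
      by (simp add: power_one_over distrib_left)
    also have "\<dots> \<le> (?B w + ?B z) / 2"
      using nev_weight_le[OF w, of t] nev_weight_le[OF z, of t] by (intro divide_right_mono add_mono) auto
    finally show ?thesis .
  qed
  show "((\<lambda>w. (nev_transform g w - nev_transform g z) / (w - z)) \<longlongrightarrow> (LINT t|lborel. g t * ?k z t))
    (at z within - \<real>)"
    unfolding tendsto_at_iff_sequentially
  proof (intro allI impI)
    fix X :: "nat \<Rightarrow> complex"
    assume X: "\<forall>i. X i \<in> - \<real> - {z}" and lim: "X \<longlonglongrightarrow> z"
    have Xi: "X i \<in> - \<real>" "X i \<noteq> z" for i
      using X by auto
    have quotient: "(nev_transform g (X i) - nev_transform g z) / (X i - z) = (LINT t|lborel. g t * ?k (X i) t)" for i
    proof -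
      have "(nev_transform g (X i) - nev_transform g z) / (X i - z)
          = (LINT t|lborel. (g t * nev_kernel t (X i) - g t * nev_kernel t z) / (X i - z))"
        unfolding nev_transform_def
        by (simp add: Bochner_Integration.integral_diff[OF integrable_nev_kernel[OF g Xi(1)] integrable_nev_kernel[OF g z]])
      also have "(\<lambda>t. (g t * nev_kernel t (X i) - g t * nev_kernel t z) / (X i - z)) = (\<lambda>t. g t * ?k (X i) t)"
        unfolding nev_kernel_difference[OF z Xi, symmetric] by (simp add: right_diff_distrib)
      finally show ?thesis .
    qed
    have "(\<lambda>i. ?B (X i)) \<longlonglongrightarrow> ?B z"
      using z by (intro tendsto_intros lim) (auto simp: complex_is_Real_iff)
    \<comment> \<open>All \<open>X i\<close> are nonreal, so that a single dominating function serves the whole sequence.\<close>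
    then have "Bseq (\<lambda>i. ?B (X i))"
      by (intro convergent_imp_Bseq convergentI)
    then obtain K where K: "\<And>i. norm (?B (X i)) \<le> K"
      unfolding Bseq_def by blast
    have "(\<lambda>i. LINT t|lborel. g t * ?k (X i) t) \<longlonglongrightarrow> (LINT t|lborel. g t * ?k z t)"
    proof (rule integral_dominated_convergence)
      show "(\<lambda>t. g t * ?k z t) \<in> borel_measurable lborel"
        using borel_measurable_integrable[OF g] meas[OF z] by simp
      show "(\<lambda>t. g t * ?k (X i) t) \<in> borel_measurable lborel" for i
        using borel_measurable_integrable[OF g] meas[OF Xi(1)] by simp
      show "integrable lborel (\<lambda>t. cmod (g t) * ((K + ?B z) / 2))"
        by (intro integrable_mult_left integrable_norm g)
      show "AE t in lborel. (\<lambda>i. g t * ?k (X i) t) \<longlonglongrightarrow> g t * ?k z t"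
        by (intro AE_I2 tendsto_intros lim) (use real_minus_nonreal_nonzero[OF z] in simp)
      show "AE t in lborel. norm (g t * ?k (X i) t) \<le> cmod (g t) * ((K + ?B z) / 2)" for i
      proof (rule AE_I2)
        fix t
        have "?B (X i) \<le> K"
          by (rule order_trans[OF abs_ge_self K[of i, unfolded real_norm_def]])
        then have "cmod (?k (X i) t) \<le> (K + ?B z) / 2"
          by (intro order_trans[OF bound[OF Xi(1)]] divide_right_mono add_right_mono) auto
        then show "norm (g t * ?k (X i) t) \<le> cmod (g t) * ((K + ?B z) / 2)"
          unfolding norm_mult[of "g t"] by (intro mult_left_mono) auto
      qed
    qed
    then show "((\<lambda>w. (nev_transform g w - nev_transform g z) / (w - z)) \<circ> X) \<longlonglongrightarrow> (LINT t|lborel. g t * ?k z t)"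
      unfolding o_def quotient .
  qed
qed

lemma herglotz_nev_transform:
  assumes int: "integrable lborel \<phi>" and nonneg: "\<And>t. \<phi> t \<ge> 0"
  shows "herglotz (nev_transform (\<lambda>t. of_real (\<phi> t)))"
  unfolding herglotz_def
proof (intro conjI ballI)
  have g: "integrable lborel (\<lambda>t. complex_of_real (\<phi> t))"
    using int by simp
  show "nev_transform (\<lambda>t. of_real (\<phi> t)) holomorphic_on - \<real>"
    by (rule holomorphic_nev_transform[OF g])
  fix z :: complex assume z: "z \<in> - \<real>"
  note int_z = integrable_nev_kernel[OF g z]
  have "Im (nev_transform (\<lambda>t. of_real (\<phi> t)) z) / Im z
      = (LINT t|lborel. Im (of_real (\<phi> t) * nev_kernel t z)) / Im z"
    unfolding nev_transform_def using integral_bounded_linear[OF bounded_linear_Im int_z] by simp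
  also have "\<dots> = (LINT t|lborel. Im (of_real (\<phi> t) * nev_kernel t z) / Im z)"
    by simp
  also have "\<dots> = (LINT t|lborel. \<phi> t * ((1 + t\<^sup>2) / (cmod (of_real t - z))\<^sup>2))"
    using z by (intro Bochner_Integration.integral_cong) (auto simp: Im_nev_kernel complex_is_Real_iff)
  also have "\<dots> \<ge> 0"
    by (intro integral_nonneg_AE AE_I2 mult_nonneg_nonneg nonneg) auto
  finally show "0 \<le> Im (nev_transform (\<lambda>t. of_real (\<phi> t)) z) / Im z" .
  show "cnj (nev_transform (\<lambda>t. of_real (\<phi> t)) z) = nev_transform (\<lambda>t. of_real (\<phi> t)) (cnj z)"
    unfolding nev_transform_def using integral_bounded_linear[OF bounded_linear_cnj int_z]
    by (simp add: cnj_nev_kernel)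
qed

lemma herglotz_add_affine:
  assumes "herglotz h" "b \<ge> 0"
  shows "herglotz (\<lambda>z. h z + of_real a + of_real b * z)"
  unfolding herglotz_def
proof (intro conjI ballI)
  show "(\<lambda>z. h z + of_real a + of_real b * z) holomorphic_on - \<real>"
    using assms by (intro holomorphic_intros) (auto simp: herglotz_def)
  fix z :: complex assume z: "z \<in> - \<real>"
  have "Im (h z + of_real a + of_real b * z) / Im z = Im (h z) / Im z + b"
    using z by (simp add: complex_is_Real_iff field_simps)
  then show "0 \<le> Im (h z + of_real a + of_real b * z) / Im z"
    using assms z by (simp add: herglotz_def)
  show "cnj (h z + of_real a + of_real b * z) = h (cnj z) + of_real a + of_real b * cnj z"
    using assms(1) z by (simp add: herglotz_def)
qed

text \<open>A normal family: locally bounded sequences have convergent subsequences by Montel's theorem, and the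
  conditions that define Herglotz functions are closed under pointwise limits.\<close>

lemma herglotz_convergent_subsequence:
  fixes h :: "nat \<Rightarrow> complex \<Rightarrow> complex"
  assumes h: "\<And>n. herglotz (h n)"
    and bound: "\<And>n z. z \<in> - \<real> \<Longrightarrow> cmod (h n z) \<le> C * ((1 + (cmod z)\<^sup>2) / \<bar>Im z\<bar>)"
  obtains g s where "herglotz g" "strict_mono (s :: nat \<Rightarrow> nat)"
    "\<And>z. z \<in> - \<real> \<Longrightarrow> (\<lambda>n. h (s n) z) \<longlonglongrightarrow> g z"
proof -
  have open_S: "open (- \<real> :: complex set)"
    by (simp add: closed_complex_Reals open_Compl)
  obtain g s where g: "g holomorphic_on - \<real>" and s: "strict_mono (s :: nat \<Rightarrow> nat)"
    and lim: "\<And>z. z \<in> - \<real> \<Longrightarrow> (\<lambda>n. h (s n) z) \<longlonglongrightarrow> g z"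
  proof (rule Montel[OF open_S, of "range h" h])
    show "f holomorphic_on - \<real>" if "f \<in> range h" for f
      using that h by (auto simp: herglotz_def)
    fix K :: "complex set" assume K: "compact K" "K \<subseteq> - \<real>"
    have "continuous_on K (\<lambda>z. C * ((1 + (cmod z)\<^sup>2) / \<bar>Im z\<bar>))"
      using K(2) by (intro continuous_intros) (auto simp: complex_is_Real_iff)
    then have "bounded ((\<lambda>z. C * ((1 + (cmod z)\<^sup>2) / \<bar>Im z\<bar>)) ` K)"
      by (intro compact_imp_bounded compact_continuous_image K)
    then obtain B where B: "\<And>z. z \<in> K \<Longrightarrow> \<bar>C * ((1 + (cmod z)\<^sup>2) / \<bar>Im z\<bar>)\<bar> \<le> B"
      unfolding bounded_iff by (auto simp: image_iff)
    have "cmod (h n z) \<le> B" if "z \<in> K" for n z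
      using bound[of z n] B[OF that] K(2) that by (meson abs_le_D1 order_trans subsetD)
    then show "\<exists>B. \<forall>f\<in>range h. \<forall>z\<in>K. cmod (f z) \<le> B"
      by blast
  qed auto
  have "herglotz g"
    unfolding herglotz_def
  proof (intro conjI ballI g)
    fix z :: complex assume z: "z \<in> - \<real>"
    then have z': "cnj z \<in> - \<real>"
      by (simp add: complex_is_Real_iff)
    have "(\<lambda>n. Im (h (s n) z) / Im z) \<longlonglongrightarrow> Im (g z) / Im z"
      using z by (intro tendsto_intros lim) (auto simp: complex_is_Real_iff)
    then show "0 \<le> Im (g z) / Im z"
      by (rule LIMSEQ_le_const) (use h z in \<open>auto simp: herglotz_def\<close>)
    have "(\<lambda>n. cnj (h (s n) z)) \<longlonglongrightarrow> cnj (g z)"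
      by (intro tendsto_intros lim z)
    moreover have "cnj (h (s n) z) = h (s n) (cnj z)" for n
      using h z by (auto simp: herglotz_def)
    ultimately show "cnj (g z) = g (cnj z)"
      using lim[OF z'] LIMSEQ_unique by auto
  qed
  then show thesis
    using s lim that by blast
qed

section \<open>Decomposition into Herglotz functions\<close>

text \<open>Since \<open>(1 + z\<^sup>2) / (t - z)\<close> differs from the Nevanlinna kernel by \<open>- z\<close>, the representation by the
  jump becomes a Nevanlinna transform plus an affine function. The coefficients are left unspecified:
  their convergence as \<open>r\<close> tends to 0 will follow from that of the other terms.\<close>

lemma jump_representation_affine:
  fixes q :: "complex \<Rightarrow> complex"
  assumes "q holomorphic_on - \<real>"
    and "\<And>z. z \<in> - \<real> \<Longrightarrow> cmod (q z) \<le> M * ((1 + (cmod z)\<^sup>2) / \<bar>Im z\<bar>)"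
    and "M \<ge> 0" "0 < r" "r < 1"
    and int: "integrable lborel (\<lambda>t. jump q r t / of_real (1 + t\<^sup>2))"
  shows "\<exists>a b. \<forall>z\<in>- \<real>. away_shift q r z =
    nev_transform (\<lambda>t. jump q r t / of_real (1 + t\<^sup>2) / (2 * pi * \<i>)) z + (a + b * z)"
proof -
  let ?g = "\<lambda>t. jump q r t / of_real (1 + t\<^sup>2) / (2 * pi * \<i>)"
  let ?a = "(away_shift q r \<i> + away_shift q r (- \<i>)) / 2"
  let ?b = "(away_shift q r \<i> - away_shift q r (- \<i>)) / (2 * \<i>) - (LINT t|lborel. ?g t)"
  have g: "integrable lborel ?g"
    using int by (rule integrable_divide)
  have "away_shift q r z = nev_transform ?g z + (?a + ?b * z)" if z: "z \<in> - \<real>" for z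
  proof -
    have nz: "Im z \<noteq> 0"
      using z by (simp add: complex_is_Real_iff)
    have repr: "away_shift q r z =
      (1 + z\<^sup>2) / (2 * pi * \<i>) * (LINT t|lborel. jump q r t / of_real (1 + t\<^sup>2) / (of_real t - z))
      + (away_shift q r \<i> * (z + \<i>) / (2 * \<i>) - away_shift q r (- \<i>) * (z - \<i>) / (2 * \<i>))"
      unfolding add_diff_eq by (rule jump_representation[OF assms(1) _ assms(3-6) nz]) (rule assms(2))
    have "(LINT t|lborel. (1 + z\<^sup>2) / (2 * pi * \<i>) * (jump q r t / of_real (1 + t\<^sup>2) / (of_real t - z)))
        = (LINT t|lborel. ?g t * nev_kernel t z - ?g t * z)"
    proof (intro Bochner_Integration.integral_cong refl)
      have "K / c * (J / w / d) = J / w / c * (K / d + z) - J / w / c * z" for K c J w d :: complex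
        by (simp add: divide_inverse algebra_simps)
      then show "(1 + z\<^sup>2) / (2 * pi * \<i>) * (jump q r t / of_real (1 + t\<^sup>2) / (of_real t - z))
          = ?g t * nev_kernel t z - ?g t * z" for t
        unfolding nev_kernel_decomp[OF z] .
    qed
    also have "\<dots> = nev_transform ?g z - (LINT t|lborel. ?g t) * z"
    proof -
      have "(LINT t|lborel. f t * nev_kernel t z - f t * z) = nev_transform f z - (LINT t|lborel. f t) * z"
        if "integrable lborel f" for f
        using integrable_nev_kernel[OF that z] that
        by (simp add: nev_transform_def)
      from this[OF g] show ?thesis .
    qed
    finally have 1: "(1 + z\<^sup>2) / (2 * pi * \<i>) * (LINT t|lborel. jump q r t / of_real (1 + t\<^sup>2) / (of_real t - z))
        = nev_transform ?g z - (LINT t|lborel. ?g t) * z"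
      by (simp only: integral_mult_right_zero)
    have 2: "U * (z + \<i>) / (2 * \<i>) - V * (z - \<i>) / (2 * \<i>) = (U + V) / 2 + (U - V) / (2 * \<i>) * z" for U V
      by (simp add: field_simps)
    have "A - B * z + (E + D * z) = A + (E + (D - B) * z)" for A B D E
      by (simp add: algebra_simps)
    then show ?thesis
      unfolding repr 1 2 .
  qed
  then show ?thesis
    by blast
qed

text \<open>The positive and negative parts of \<open>Re g\<close> and \<open>Im g\<close> are densities of the four Herglotz functions.\<close>

lemma nev_transform_split:
  assumes g: "integrable lborel g"
  obtains H1 H2 H3 H4 where "herglotz H1" "herglotz H2" "herglotz H3" "herglotz H4"
    "\<And>z. z \<in> - \<real> \<Longrightarrow> nev_transform g z = (H1 z - H2 z) + \<i> * (H3 z - H4 z)"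
    "\<And>H z. H \<in> {H1, H2, H3, H4} \<Longrightarrow> z \<in> - \<real> \<Longrightarrow>
       cmod (H z) \<le> 2 * (LINT t|lborel. cmod (g t)) * ((1 + (cmod z)\<^sup>2) / \<bar>Im z\<bar>)"
proof
  define pos where "pos = (\<lambda>x::real. max 0 x)"
  define T where "T = (\<lambda>u::complex \<Rightarrow> real. nev_transform (\<lambda>t. of_real (pos (u (g t)))))"
  have pos_diff: "pos x - pos (- x) = x" for x
    by (simp add: pos_def max_def)
  have int: "integrable lborel (\<lambda>t. pos (u (g t)))" if "bounded_linear u" for u :: "complex \<Rightarrow> real"
    unfolding pos_def using integrable_bounded_linear[OF that g] by (intro integrable_max) auto
  have herg: "herglotz (T u)" if "bounded_linear u" for u
    unfolding T_def by (intro herglotz_nev_transform int that) (simp add: pos_def)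
  have bound: "cmod (T u z) \<le> 2 * (LINT t|lborel. cmod (g t)) * ((1 + (cmod z)\<^sup>2) / \<bar>Im z\<bar>)"
    if u: "bounded_linear u" "\<And>w. \<bar>u w\<bar> \<le> cmod w" and z: "z \<in> - \<real>" for u z
  proof -
    have le: "\<bar>pos (u w)\<bar> \<le> cmod w" for w
      using u(2)[of w] by (auto simp: pos_def max_def)
    have "cmod (T u z) \<le> (LINT t|lborel. cmod (of_real (pos (u (g t))))) * (2 * ((1 + (cmod z)\<^sup>2) / \<bar>Im z\<bar>))"
      unfolding T_def by (intro norm_nev_transform_le z) (use int[OF u(1)] in simp)
    also have "\<dots> \<le> (LINT t|lborel. cmod (g t)) * (2 * ((1 + (cmod z)\<^sup>2) / \<bar>Im z\<bar>))"
      using int[OF u(1)] g le by (intro mult_right_mono integral_mono) auto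
    finally show ?thesis
      by (simp only: mult_ac)
  qed
  have bl: "bounded_linear Re" "bounded_linear (\<lambda>w. - Re w)" "bounded_linear Im" "bounded_linear (\<lambda>w. - Im w)"
    by (intro bounded_linear_minus bounded_linear_Re bounded_linear_Im)+
  show "herglotz (T Re)" "herglotz (T (\<lambda>w. - Re w))" "herglotz (T Im)" "herglotz (T (\<lambda>w. - Im w))"
    by (intro herg bl)+
  show "cmod (H z) \<le> 2 * (LINT t|lborel. cmod (g t)) * ((1 + (cmod z)\<^sup>2) / \<bar>Im z\<bar>)"
    if "H \<in> {T Re, T (\<lambda>w. - Re w), T Im, T (\<lambda>w. - Im w)}" "z \<in> - \<real>" for H z
    using that(1) bound[OF bl(1) _ that(2)] bound[OF bl(2) _ that(2)] bound[OF bl(3) _ that(2)] bound[OF bl(4) _ that(2)]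
    by (auto simp: abs_Re_le_cmod abs_Im_le_cmod)
  show "nev_transform g z = (T Re z - T (\<lambda>w. - Re w) z) + \<i> * (T Im z - T (\<lambda>w. - Im w) z)"
    if z: "z \<in> - \<real>" for z
  proof -
    have I: "integrable lborel (\<lambda>t. complex_of_real (pos (u (g t))) * nev_kernel t z)" if "bounded_linear u" for u
      by (intro integrable_nev_kernel z) (use int[OF that] in simp)
    have "(T Re z - T (\<lambda>w. - Re w) z) + \<i> * (T Im z - T (\<lambda>w. - Im w) z)
      = (LINT t|lborel. (of_real (pos (Re (g t))) * nev_kernel t z - of_real (pos (- Re (g t))) * nev_kernel t z)
          + \<i> * (of_real (pos (Im (g t))) * nev_kernel t z - of_real (pos (- Im (g t))) * nev_kernel t z))"
      unfolding T_def nev_transform_def using I[OF bl(1)] I[OF bl(2)] I[OF bl(3)] I[OF bl(4)]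
      by simp
    also have "\<dots> = (LINT t|lborel. g t * nev_kernel t z)"
    proof (intro Bochner_Integration.integral_cong refl)
      fix t
      have "g t = of_real (pos (Re (g t)) - pos (- Re (g t))) + \<i> * of_real (pos (Im (g t)) - pos (- Im (g t)))"
        unfolding pos_diff by (rule complex_eq)
      then have "g t * nev_kernel t z = (of_real (pos (Re (g t)) - pos (- Re (g t)))
          + \<i> * of_real (pos (Im (g t)) - pos (- Im (g t)))) * nev_kernel t z"
        by (rule arg_cong)
      then show "(of_real (pos (Re (g t))) * nev_kernel t z - of_real (pos (- Re (g t))) * nev_kernel t z)
          + \<i> * (of_real (pos (Im (g t))) * nev_kernel t z - of_real (pos (- Im (g t))) * nev_kernel t z)
          = g t * nev_kernel t z"
        by (simp add: algebra_simps)
    qed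
    finally show ?thesis
      by (simp add: nev_transform_def)
  qed
qed

text \<open>An affine function is determined by its values at \<open>\<i>\<close> and \<open>- \<i>\<close>, so pointwise convergence forces the
  coefficients to converge.\<close>

lemma limit_of_affine:
  fixes D :: "complex \<Rightarrow> complex"
  assumes lim: "\<And>z. z \<in> - \<real> \<Longrightarrow> (\<lambda>n. a n + b n * z) \<longlonglongrightarrow> D z"
  shows "\<exists>\<alpha> \<beta>. \<forall>z\<in>- \<real>. D z = \<alpha> + \<beta> * z"
proof (intro exI ballI)
  have ii: "\<i> \<in> - \<real>" "- \<i> \<in> - \<real>"
    by (auto simp: complex_is_Real_iff)
  fix z :: complex assume z: "z \<in> - \<real>"
  have "(\<lambda>n. ((a n + b n * \<i>) + (a n + b n * (- \<i>))) / 2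
      + ((a n + b n * \<i>) - (a n + b n * (- \<i>))) / (2 * \<i>) * z)
    \<longlonglongrightarrow> (D \<i> + D (- \<i>)) / 2 + (D \<i> - D (- \<i>)) / (2 * \<i>) * z"
    by (intro tendsto_intros lim ii) auto
  moreover have "((a n + b n * \<i>) + (a n + b n * (- \<i>))) / 2
      + ((a n + b n * \<i>) - (a n + b n * (- \<i>))) / (2 * \<i>) * z = a n + b n * z" for n
    by (simp add: field_simps)
  ultimately show "D z = (D \<i> + D (- \<i>)) / 2 + (D \<i> - D (- \<i>)) / (2 * \<i>) * z"
    using LIMSEQ_unique[OF lim[OF z]] by simp
qed

text \<open>Real constants and nonnegative multiples of \<open>z\<close> are Herglotz functions; the real and imaginary parts
  of \<open>\<beta>\<close> are split by sign.\<close>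

lemma quasi_herglotz_add_affine:
  assumes h: "herglotz h1" "herglotz h2" "herglotz h3" "herglotz h4"
    and q: "\<And>z. z \<in> - \<real> \<Longrightarrow> q z = (h1 z - h2 z) + \<i> * (h3 z - h4 z) + (\<alpha> + \<beta> * z)"
  shows "quasi_herglotz q"
  unfolding quasi_herglotz_def
proof (rule exI[of _ "\<lambda>z. h1 z + of_real (Re \<alpha>) + of_real (max 0 (Re \<beta>)) * z"],
    rule exI[of _ "\<lambda>z. h2 z + of_real 0 + of_real (max 0 (- Re \<beta>)) * z"],
    rule exI[of _ "\<lambda>z. h3 z + of_real (Im \<alpha>) + of_real (max 0 (Im \<beta>)) * z"],
    rule exI[of _ "\<lambda>z. h4 z + of_real 0 + of_real (max 0 (- Im \<beta>)) * z"],
    intro conjI ballI)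
  show "herglotz (\<lambda>z. h1 z + of_real (Re \<alpha>) + of_real (max 0 (Re \<beta>)) * z)"
    "herglotz (\<lambda>z. h2 z + of_real 0 + of_real (max 0 (- Re \<beta>)) * z)"
    "herglotz (\<lambda>z. h3 z + of_real (Im \<alpha>) + of_real (max 0 (Im \<beta>)) * z)"
    "herglotz (\<lambda>z. h4 z + of_real 0 + of_real (max 0 (- Im \<beta>)) * z)"
    by (intro herglotz_add_affine h; simp)+
  fix z :: complex assume z: "z \<in> - \<real>"
  have \<beta>: "\<beta> = of_real (max 0 (Re \<beta>)) - of_real (max 0 (- Re \<beta>))
      + \<i> * (of_real (max 0 (Im \<beta>)) - of_real (max 0 (- Im \<beta>)))"
    by (auto simp: complex_eq_iff max_def)
  have "\<alpha> + \<beta> * z = of_real (Re \<alpha>) + \<i> * of_real (Im \<alpha>) + (of_real (max 0 (Re \<beta>)) - of_real (max 0 (- Re \<beta>))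
      + \<i> * (of_real (max 0 (Im \<beta>)) - of_real (max 0 (- Im \<beta>)))) * z"
    unfolding \<beta>[symmetric] complex_eq[symmetric] ..
  then show "q z = (h1 z + of_real (Re \<alpha>) + of_real (max 0 (Re \<beta>)) * z
        - (h2 z + of_real 0 + of_real (max 0 (- Re \<beta>)) * z))
      + \<i> * (h3 z + of_real (Im \<alpha>) + of_real (max 0 (Im \<beta>)) * z
        - (h4 z + of_real 0 + of_real (max 0 (- Im \<beta>)) * z))"
    unfolding q[OF z] by (simp add: algebra_simps)
qed

lemma jump_density_integrable:
  fixes q :: "complex \<Rightarrow> complex"
  assumes q: "q holomorphic_on - \<real>" and "0 < r"
    and C: "(\<integral>\<^sup>+ t. ennreal (cmod (jump q r t) / (1 + t\<^sup>2)) \<partial>lborel) \<le> ennreal C" "C \<ge> 0"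
  shows "integrable lborel (\<lambda>t. jump q r t / of_real (1 + t\<^sup>2))"
    and "(LINT t|lborel. cmod (jump q r t / of_real (1 + t\<^sup>2))) \<le> C"
proof -
  let ?g = "\<lambda>t. jump q r t / of_real (1 + t\<^sup>2)"
  have pos: "1 + t\<^sup>2 > 0" for t :: real
    using zero_le_power2[of t] by linarith
  have ne: "complex_of_real (1 + t\<^sup>2) \<noteq> 0" for t
    unfolding of_real_eq_0_iff using pos[of t] by simp
  have norm: "cmod (?g t) = cmod (jump q r t) / (1 + t\<^sup>2)" for t
    unfolding norm_divide norm_of_real using pos[of t] by simp
  note cont = continuous_on_horizontal_line[OF q]
  have "continuous_on UNIV ?g"
    using \<open>0 < r\<close> ne by (intro continuous_intros cont) auto
  then have meas: "?g \<in> borel_measurable lborel"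
    unfolding measurable_lborel2 by (rule borel_measurable_continuous_onI)
  have nn: "(\<integral>\<^sup>+ t. ennreal (cmod (?g t)) \<partial>lborel) \<le> ennreal C"
    using C(1) unfolding norm .
  show int: "integrable lborel ?g"
    by (rule integrableI_bounded[OF meas]) (use order.strict_trans1[OF nn] in simp)
  have eq: "ennreal (LINT t|lborel. cmod (?g t)) = (\<integral>\<^sup>+ t. ennreal (cmod (?g t)) \<partial>lborel)"
    by (rule nn_integral_eq_integral[symmetric]) (use integrable_norm[OF int] in auto)
  show "(LINT t|lborel. cmod (?g t)) \<le> C"
    using nn unfolding eq[symmetric] ennreal_le_iff[OF C(2)] .
qed

text \<open>For \<open>r = 1 / (n + 2)\<close> the shifted function is an affine function plus a combination of four Herglotz
  functions with bounds independent of \<open>n\<close>. Along a common subsequence these four converge to Herglotz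
  functions, while the shifted functions converge to \<open>q\<close>; hence the affine parts converge too.\<close>

lemma quasi_herglotz_if_growth_and_jump:
  fixes q :: "complex \<Rightarrow> complex"
  assumes q: "q holomorphic_on - \<real>" and "M \<ge> 0"
    and growth: "\<And>z. z \<in> - \<real> \<Longrightarrow> cmod (q z) \<le> M * ((1 + (cmod z)\<^sup>2) / \<bar>Im z\<bar>)"
    and sup: "(SUP r\<in>{0<..<1::real}. \<integral>\<^sup>+ t. ennreal (cmod (jump q r t) / (1 + t\<^sup>2)) \<partial>lborel) < \<infinity>"
  shows "quasi_herglotz q"
proof -
  obtain C where C: "C \<ge> 0"
    "(SUP r\<in>{0<..<1::real}. \<integral>\<^sup>+ t. ennreal (cmod (jump q r t) / (1 + t\<^sup>2)) \<partial>lborel) = ennreal C"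
    using sup by (cases "SUP r\<in>{0<..<1::real}. \<integral>\<^sup>+ t. ennreal (cmod (jump q r t) / (1 + t\<^sup>2)) \<partial>lborel") auto
  define \<rho> where "\<rho> = (\<lambda>n. 1 / (real n + 2))"
  have \<rho>: "0 < \<rho> n" "\<rho> n < 1" for n
    by (auto simp: \<rho>_def)
  have \<rho>_lim: "\<rho> \<longlonglongrightarrow> 0"
    unfolding \<rho>_def by real_asymp
  define g where "g = (\<lambda>n t. jump q (\<rho> n) t / of_real (1 + t\<^sup>2) / (2 * pi * \<i>))"
  have nn: "(\<integral>\<^sup>+ t. ennreal (cmod (jump q (\<rho> n) t) / (1 + t\<^sup>2)) \<partial>lborel) \<le> ennreal C" for n
    unfolding C(2)[symmetric] using \<rho>[of n] by (intro SUP_upper) auto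
  note density = jump_density_integrable[OF q \<rho>(1) nn C(1)]
  have g: "integrable lborel (g n)" for n
    unfolding g_def by (intro integrable_divide density(1))
  have g_le: "(LINT t|lborel. cmod (g n t)) \<le> C" for n
  proof -
    have "(LINT t|lborel. cmod (g n t)) \<le> (LINT t|lborel. cmod (jump q (\<rho> n) t / of_real (1 + t\<^sup>2)))"
    proof (rule integral_mono)
      show "cmod (g n t) \<le> cmod (jump q (\<rho> n) t / of_real (1 + t\<^sup>2))" for t
      proof -
        have "cmod (g n t) = cmod (jump q (\<rho> n) t / of_real (1 + t\<^sup>2)) / (2 * pi)"
          unfolding g_def norm_divide[of _ "2 * pi * \<i>"] by (simp add: norm_mult)
        also have "\<dots> \<le> cmod (jump q (\<rho> n) t / of_real (1 + t\<^sup>2)) / 1"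
          using pi_ge_two by (intro divide_left_mono) auto
        finally show ?thesis
          by simp
      qed
    qed (intro integrable_norm g density(1))+
    also have "\<dots> \<le> C"
      by (rule density(2))
    finally show ?thesis .
  qed
  have "\<exists>a b. \<forall>z\<in>- \<real>. away_shift q (\<rho> n) z = nev_transform (g n) z + (a + b * z)" for n
    unfolding g_def by (rule jump_representation_affine[OF q growth \<open>M \<ge> 0\<close> \<rho> density(1)])
  then obtain a b where repr: "\<And>n z. z \<in> - \<real> \<Longrightarrow> away_shift q (\<rho> n) z = nev_transform (g n) z + (a n + b n * z)"
    by metis
  have "\<exists>H1 H2 H3 H4. (\<forall>H\<in>{H1, H2, H3, H4}. herglotz H \<and>
        (\<forall>z\<in>- \<real>. cmod (H z) \<le> 2 * C * ((1 + (cmod z)\<^sup>2) / \<bar>Im z\<bar>))) \<and>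
      (\<forall>z\<in>- \<real>. nev_transform (g n) z = (H1 z - H2 z) + \<i> * (H3 z - H4 z))" for n
  proof -
    obtain H1 H2 H3 H4 where H: "herglotz H1" "herglotz H2" "herglotz H3" "herglotz H4"
      "\<And>z. z \<in> - \<real> \<Longrightarrow> nev_transform (g n) z = (H1 z - H2 z) + \<i> * (H3 z - H4 z)"
      and bound: "\<And>H z. H \<in> {H1, H2, H3, H4} \<Longrightarrow> z \<in> - \<real> \<Longrightarrow>
       cmod (H z) \<le> 2 * (LINT t|lborel. cmod (g n t)) * ((1 + (cmod z)\<^sup>2) / \<bar>Im z\<bar>)"
      using nev_transform_split[OF g] by metis
    have "cmod (H z) \<le> 2 * C * ((1 + (cmod z)\<^sup>2) / \<bar>Im z\<bar>)" if "H \<in> {H1, H2, H3, H4}" "z \<in> - \<real>" for H z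
      using bound[OF that] by (rule order_trans) (intro mult_right_mono mult_left_mono g_le; simp)
    then show ?thesis
      using H by (intro exI[of _ H1] exI[of _ H2] exI[of _ H3] exI[of _ H4]) auto
  qed
  then obtain H1 H2 H3 H4 where H: "\<And>n. \<forall>H\<in>{H1 n, H2 n, H3 n, H4 n}. herglotz H \<and>
        (\<forall>z\<in>- \<real>. cmod (H z) \<le> 2 * C * ((1 + (cmod z)\<^sup>2) / \<bar>Im z\<bar>))"
      and split: "\<And>n z. z \<in> - \<real> \<Longrightarrow> nev_transform (g n) z = (H1 n z - H2 n z) + \<i> * (H3 n z - H4 n z)"
    by metis
  \<comment> \<open>Successive refinements give one subsequence along which all four families converge.\<close>
  obtain h1 s1 where h1: "herglotz h1" and s1: "strict_mono s1"
    and lim1: "\<And>z. z \<in> - \<real> \<Longrightarrow> (\<lambda>n. H1 (s1 n) z) \<longlonglongrightarrow> h1 z"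
    by (rule herglotz_convergent_subsequence[of H1 "2 * C"]) (use H in auto)
  obtain h2 s2 where h2: "herglotz h2" and s2: "strict_mono s2"
    and lim2: "\<And>z. z \<in> - \<real> \<Longrightarrow> (\<lambda>n. H2 (s1 (s2 n)) z) \<longlonglongrightarrow> h2 z"
    by (rule herglotz_convergent_subsequence[of "\<lambda>n. H2 (s1 n)" "2 * C"]) (use H in auto)
  obtain h3 s3 where h3: "herglotz h3" and s3: "strict_mono s3"
    and lim3: "\<And>z. z \<in> - \<real> \<Longrightarrow> (\<lambda>n. H3 (s1 (s2 (s3 n))) z) \<longlonglongrightarrow> h3 z"
    by (rule herglotz_convergent_subsequence[of "\<lambda>n. H3 (s1 (s2 n))" "2 * C"]) (use H in auto)
  obtain h4 s4 where h4: "herglotz h4" and s4: "strict_mono s4"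
    and lim4: "\<And>z. z \<in> - \<real> \<Longrightarrow> (\<lambda>n. H4 (s1 (s2 (s3 (s4 n)))) z) \<longlonglongrightarrow> h4 z"
    by (rule herglotz_convergent_subsequence[of "\<lambda>n. H4 (s1 (s2 (s3 n)))" "2 * C"]) (use H in auto)
  define s where "s = s1 \<circ> s2 \<circ> s3 \<circ> s4"
  have mono: "strict_mono s" "strict_mono (s2 \<circ> s3 \<circ> s4)" "strict_mono (s3 \<circ> s4)"
    unfolding s_def by (intro strict_mono_o s1 s2 s3 s4)+
  define P where "P = (\<lambda>z. (h1 z - h2 z) + \<i> * (h3 z - h4 z))"
  \<comment> \<open>The first three limits are carried over to the last refinement.\<close>
  have P: "(\<lambda>n. nev_transform (g (s n)) z) \<longlonglongrightarrow> P z" if z: "z \<in> - \<real>" for z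
    unfolding split[OF z] P_def
    using LIMSEQ_subseq_LIMSEQ[OF lim1[OF z] mono(2)] LIMSEQ_subseq_LIMSEQ[OF lim2[OF z] mono(3)]
      LIMSEQ_subseq_LIMSEQ[OF lim3[OF z] s4] lim4[OF z]
    by (intro tendsto_intros) (simp_all add: s_def o_def)
  have q_lim: "(\<lambda>n. away_shift q (\<rho> (s n)) z) \<longlonglongrightarrow> q z" if z: "z \<in> - \<real>" for z
  proof -
    have "open (- \<real> :: complex set)"
      by (simp add: closed_complex_Reals open_Compl)
    then have "isCont q z"
      using holomorphic_on_imp_continuous_on[OF q] z by (simp add: continuous_on_eq_continuous_at)
    moreover have "(\<lambda>n. if Im z > 0 then z + \<i> * of_real (\<rho> (s n)) else z - \<i> * of_real (\<rho> (s n))) \<longlonglongrightarrow> z"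
    proof -
      have "(\<lambda>n. \<rho> (s n)) \<longlonglongrightarrow> 0"
        using LIMSEQ_subseq_LIMSEQ[OF \<rho>_lim mono(1)] by (simp add: o_def)
      then have "(\<lambda>n. \<i> * of_real (\<rho> (s n))) \<longlonglongrightarrow> \<i> * of_real 0"
        by (intro tendsto_intros)
      from tendsto_add[OF tendsto_const this, of z] tendsto_diff[OF tendsto_const this, of z]
      show ?thesis
        by (cases "Im z > 0") simp_all
    qed
    ultimately show ?thesis
      by (rule isCont_tendsto_compose)
  qed
  have "(\<lambda>n. a (s n) + b (s n) * z) \<longlonglongrightarrow> q z - P z" if z: "z \<in> - \<real>" for z
    using tendsto_diff[OF q_lim[OF z] P[OF z]] by (simp add: repr[OF z])
  then have "\<exists>\<alpha> \<beta>. \<forall>z\<in>- \<real>. q z - P z = \<alpha> + \<beta> * z"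
    by (rule limit_of_affine)
  then obtain \<alpha> \<beta> where "\<And>z. z \<in> - \<real> \<Longrightarrow> q z - P z = \<alpha> + \<beta> * z"
    by blast
  then have "q z = (h1 z - h2 z) + \<i> * (h3 z - h4 z) + (\<alpha> + \<beta> * z)" if "z \<in> - \<real>" for z
    using that by (simp add: P_def algebra_simps)
  then show ?thesis
    by (rule quasi_herglotz_add_affine[OF h1 h2 h3 h4])
qed

section \<open>The characterization\<close>

theorem theorem4p1:
  fixes q :: "complex \<Rightarrow> complex"
  assumes "q holomorphic_on (- \<real>)"
  shows "quasi_herglotz q \<longleftrightarrow>
    (\<exists>M::real. M \<ge> 0 \<and>
       (\<forall>z\<in>- \<real>. cmod (q z) \<le> M * ((1 + (cmod z)\<^sup>2) / \<bar>Im z\<bar>))) \<and>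
    (SUP r\<in>{0<..<1::real}.
       \<integral>\<^sup>+ t. ennreal (cmod (q (Complex t r) - q (Complex t (- r))) / (1 + t\<^sup>2)) \<partial>lborel) < \<infinity>"
proof
  assume "quasi_herglotz q"
  then show "(\<exists>M::real. M \<ge> 0 \<and>
       (\<forall>z\<in>- \<real>. cmod (q z) \<le> M * ((1 + (cmod z)\<^sup>2) / \<bar>Im z\<bar>))) \<and>
    (SUP r\<in>{0<..<1::real}.
       \<integral>\<^sup>+ t. ennreal (cmod (jump q r t) / (1 + t\<^sup>2)) \<partial>lborel) < \<infinity>"
    using quasi_herglotz_growth_and_jump by blast
next
  assume "(\<exists>M::real. M \<ge> 0 \<and>
       (\<forall>z\<in>- \<real>. cmod (q z) \<le> M * ((1 + (cmod z)\<^sup>2) / \<bar>Im z\<bar>))) \<and>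
    (SUP r\<in>{0<..<1::real}.
       \<integral>\<^sup>+ t. ennreal (cmod (jump q r t) / (1 + t\<^sup>2)) \<partial>lborel) < \<infinity>"
  then show "quasi_herglotz q"
    using quasi_herglotz_if_growth_and_jump[OF assms] by blast
qed

end
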